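(* Let $t$ be a prime power, $q=t^2$, and let $\mathcal{X}\subset\mathbb{P}^4(\mathbb{F}_q)$ be the non-degenerate hermitian variety $x_0^{t+1}+x_1^{t+1}+x_2^{t+1}+x_3^{t+1}+x_4^{t+1}=0$. As $\mathcal{Q}$ ranges over the quadrics of $\mathbb{P}^4(\mathbb{F}_q)$, the four largest values of $\#(\mathcal{X}\cap\mathcal{Q})(\mathbb{F}_q)$ are, in decreasing order, $$2t^5+t^3+2t^2+1,\quad 2t^5+t^3+t^2+1,\quad 2t^5+2t^2+1,\quad 2t^5+t^2+1.$$ Moreover, if $t\ne 2,3$, then for every quadric $\mathcal{Q}$ for which $\#(\mathcal{X}\cap\mathcal{Q})(\mathbb{F}_q)$ is not one of these four values, either $$\#(\mathcal{X}\cap\mathcal{Q})(\mathbb{F}_q)=2t^5-t^3+2t^2+1\quad\text{or}\quad \#(\mathcal{X}\cap\mathcal{Q})(\mathbb{F}_q)\le 2t^5-t^4+3t^3-t+1.$$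
   Context: A quadric in $\mathbb{P}^4(\mathbb{F}_q)$ is the zero set $Z(f)$ of a nonzero form (homogeneous polynomial) $f$ of degree 2 in $x_0,\dots,x_4$ with coefficients in $\mathbb{F}_q$. *)

theory Defs
  imports
    "HOL-Analysis.Cartesian_Space"
    "HOL-Library.Poly_Mapping"
    "HOL-Number_Theory.Prime_Powers"
begin

definition proj_space :: "('a::field ^ 'n::finite) set set" where
  "proj_space = {L. vec.subspace L \<and> vec.dim L = 1}"

text \<open>
  A polynomial in variables indexed by \<open>'n\<close> is a finitely supported map from exponent
  vectors to coefficients. So a form is nonzero when it has a nonzero coefficient, whether or not
  it vanishes as a function, and no restriction on the characteristic is needed.
\<close>

type_synonym ('n, 'a) mpolynomial = "('n \<Rightarrow>\<^sub>0 nat) \<Rightarrow>\<^sub>0 'a"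

definition eval_at ::
  "('n::finite, 'a::comm_semiring_1) mpolynomial \<Rightarrow> 'a ^ 'n \<Rightarrow> 'a" where
  "eval_at f x =
     (\<Sum>m\<in>Poly_Mapping.keys f.
        Poly_Mapping.lookup f m * (\<Prod>i\<in>UNIV. x $ i ^ Poly_Mapping.lookup m i))"

definition homogeneous_of_degree ::
  "nat \<Rightarrow> ('n::finite, 'a::zero) mpolynomial \<Rightarrow> bool" where
  "homogeneous_of_degree d f \<longleftrightarrow>
     (\<forall>m\<in>Poly_Mapping.keys f. (\<Sum>i\<in>UNIV. Poly_Mapping.lookup m i) = d)"

text \<open>
  A point is a line through the origin, so it is required that all of its representatives
  (and trivially the zero vector) satisfy the homogeneous equation
  (of positive degree).
\<close>

definition zero_set ::
  "('n::finite, 'a::field) mpolynomial \<Rightarrow> ('a ^ 'n) set set" where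
  "zero_set f = {L \<in> proj_space. \<forall>v\<in>L. eval_at f v = 0}"

definition quadrics :: "('a::field ^ 'n::finite) set set set" where
  "quadrics = {zero_set f | f. f \<noteq> 0 \<and> homogeneous_of_degree 2 f}"

text \<open>
  Over the field with \<open>t\<^sup>2\<close> elements this is the standard non-degenerate hermitian variety.
\<close>

definition hermitian_variety :: "nat \<Rightarrow> ('a::field ^ 'n::finite) set set" where
  "hermitian_variety t = {L \<in> proj_space. \<forall>v\<in>L. (\<Sum>i\<in>UNIV. v $ i ^ (t + 1)) = 0}"

end

theory Submission
  imports Defs "HOL-Computational_Algebra.Polynomial" "HOL-Library.Real_Mod" "HOL-Number_Theory.Cong"
begin

text \<open>
  If the quadratic form \<open>f\<close> vanishes on a hyperplane, it is a product of two linear forms, the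
  section is a union of two hyperplane sections, and inclusion-exclusion counts it exactly in
  terms of the position of the two poles with respect to the hermitian form \<open>h\<close>.

  Otherwise let \<open>\<psi>\<close> be an additive character of the field \<open>F\<close> of order \<open>q = t\<^sup>2\<close> that is trivial
  on elements of trace \<open>0\<close>, and count the common zeros of \<open>h(x,x)\<close> and \<open>f\<close> by the sums
  \<open>S(\<theta>, b) = \<Sum>x. \<psi> (\<theta> h(x,x) + b f(x))\<close>. Then \<open>\<bar>S(\<theta>, b)\<bar>\<^sup>2\<close> is at most \<open>q\<^sup>5\<close> times the size of the
  radical, the solution set of \<open>\<tau> x\<^sup>(\<^sup>t\<^sup>) + b B x = 0\<close>, where \<open>\<tau> = \<theta> + \<theta>\<^sup>t\<close>, \<open>x\<^sup>(\<^sup>t\<^sup>)\<close> is the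
  coordinatewise \<open>t\<close>-th power and \<open>B\<close> is the matrix of the polar form of \<open>f\<close>. For \<open>\<tau> \<noteq> 0\<close> and
  \<open>b \<noteq> 0\<close> this is a vector space over the subfield \<open>K\<close> of order \<open>t\<close> whose \<open>K\<close>-independent vectors
  are \<open>F\<close>-independent, so it has at most \<open>t\<^sup>r\<close> elements, \<open>r\<close> being the rank of \<open>B\<close>. That bound is
  sufficient unless \<open>r = 5\<close>; in that case a radical with \<open>t\<^sup>5\<close> elements forces, for each \<open>\<tau>\<close>, all
  but \<open>t + 1\<close> of the others to be trivial.
\<close>

section \<open>Fields of square order\<close>

text \<open>\<open>h(x,x)\<close> is a quadratic form over \<open>K\<close> but not over
  \<open>F\<close>. Radicals are therefore \<open>K\<close>-spaces, an odd power of \<open>t\<close>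
  is a possible size, and \<open>sqrt t\<close> enters the estimates. As \<open>h(x,x)\<close> lies
  in \<open>K\<close>, only the trace \<open>\<tau>\<close> of \<open>\<theta>\<close> matters:
  terms with \<open>\<tau> = 0\<close> count the zeros of \<open>f\<close>, those with
  \<open>b = 0\<close> the isotropic vectors, and only the others need estimating. The obstacle is
  rank 5. Radicals of \<open>t ^ 4\<close> elements already give a bound on vectors with leading
  terms \<open>2 * t ^ 7 - t ^ 6\<close>, exactly those of the claim, whereas \<open>t ^ 5\<close>
  elements for every \<open>b\<close> would give order \<open>t ^ 7 * sqrt t\<close>. No size
  strictly between \<open>t ^ 4\<close> and \<open>t ^ 5\<close> occurs, so this one case remains,
  and there the scarcity of nontrivial radicals makes up for their size. In characteristic 2 the
  polar form can vanish at a vector where \<open>f\<close> does not; such forms have a separate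
  point count. For \<open>t = 2\<close> the claimed bound is 71, above the fourth value 69, so a
  sharper numerical bound is carried along.\<close>

lemma card_fibres_full:
  assumes "finite A" "finite B" "f ` A \<subseteq> B" "c > 0"
    and fib: "\<And>b. b \<in> B \<Longrightarrow> card {a \<in> A. f a = b} \<le> c"
    and "c * d \<le> card A" "card B \<le> d"
  shows "card B = d" and "\<And>b. b \<in> B \<Longrightarrow> card {a \<in> A. f a = b} = c"
proof -
  have tot: "card A = (\<Sum>b\<in>B. card {a \<in> A. f a = b})"
    using sum.group[OF assms(1,2,3), of "\<lambda>_. 1::nat"] by simp
  also have "\<dots> \<le> (\<Sum>b\<in>B. c)"
    by (rule sum_mono) (rule fib)
  finally have le: "card A \<le> c * card B"
    by (simp add: mult.commute)
  with assms show cB: "card B = d"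
    by (metis le_antisym le_trans mult_le_cancel1)
  show "card {a \<in> A. f a = b} = c" if "b \<in> B" for b
  proof (rule ccontr)
    assume "card {a \<in> A. f a = b} \<noteq> c"
    then have "(\<Sum>b\<in>B. card {a \<in> A. f a = b}) < (\<Sum>b\<in>B. c)"
      using fib that assms(2) by (intro sum_strict_mono_ex1) (auto intro!: bexI[of _ b] simp: le_neq_trans)
    then show False
      using tot cB assms(6) by (simp add: mult.commute)
  qed
qed

lemma card_power_eq_le:
  fixes b :: "'a::{field,finite}"
  assumes "n > 0"
  shows "card {x. x ^ n = b} \<le> n"
proof -
  define p where "p = monom (1::'a) n + [:- b:]"
  have dg: "degree p = n"
    unfolding p_def using assms by (subst degree_add_eq_left) (auto simp: degree_monom_eq)
  then have "p \<noteq> 0"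
    using assms by auto
  moreover have "{x. poly p x = 0} = {x. x ^ n = b}"
    by (auto simp: p_def poly_monom)
  ultimately show ?thesis
    using card_poly_roots_bound[of p] dg by simp
qed

lemma card_power_add_linear_eq_le:
  fixes a b :: "'a::{field,finite}"
  assumes "n > 1"
  shows "card {x. x ^ n + a * x = b} \<le> n"
proof -
  define p where "p = monom (1::'a) n + [:- b, a:]"
  have dg: "degree p = n"
    unfolding p_def using assms
    by (subst degree_add_eq_left) (auto simp: degree_monom_eq intro: le_less_trans[OF degree_pCons_le])
  then have "p \<noteq> 0"
    using assms by auto
  moreover have "{x. poly p x = 0} = {x. x ^ n + a * x = b}"
    by (auto simp: p_def poly_monom algebra_simps)
  ultimately show ?thesis
    using card_poly_roots_bound[of p] dg by simp
qed

text \<open>Multiplication by a nonzero \<open>x\<close> permutes the nonzero elements; compare the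
  products over all of them.\<close>

lemma power_CARD_eq_self:
  fixes x :: "'a::{field,finite}"
  shows "x ^ CARD('a) = x"
proof (cases "x = 0")
  case False
  have "(\<Prod>y\<in>UNIV-{0}. y) = (\<Prod>y\<in>UNIV-{0}. x * y)"
    by (rule prod.reindex_bij_witness[of _ "\<lambda>y. x * y" "\<lambda>y. y / x"]) (use False in auto)
  also have "\<dots> = x ^ (CARD('a) - 1) * (\<Prod>y\<in>UNIV-{0}. y)"
    by (simp add: prod.distrib)
  finally have "x ^ (CARD('a) - 1) = 1"
    by simp
  moreover have "CARD('a) = Suc (CARD('a) - 1)"
    by simp
  ultimately show ?thesis
    by (metis mult.right_neutral power_Suc)
qed simp

locale quadratic_extension =
  fixes t :: nat and F :: "'a::{field,finite} itself"
  assumes primepow_t: "primepow t" and card_F: "CARD('a) = t\<^sup>2"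
begin

lemma t_ge_2: "t \<ge> 2"
  using primepow_gt_Suc_0[OF primepow_t] by simp

lemma CHAR_dvd_CARD: "CHAR('a) dvd CARD('a)"
proof -
  have "(\<Sum>x\<in>UNIV. x) = (\<Sum>x\<in>UNIV. x + (1::'a))"
    by (rule sum.reindex_bij_witness[of _ "\<lambda>x. x + 1" "\<lambda>x. x - 1"]) auto
  also have "\<dots> = (\<Sum>x\<in>UNIV. x) + of_nat CARD('a)"
    by (simp add: sum.distrib)
  finally show ?thesis
    by (simp add: of_nat_eq_0_iff_char_dvd)
qed

lemma prime_CHAR: "prime CHAR('a)"
  by (simp add: prime_CHAR_semidom finite_imp_CHAR_pos)

text \<open>This makes the \<open>t\<close>-th power an iterate of the Frobenius map, hence
  additive.\<close>

lemma t_eq_CHAR_power: "\<exists>k. t = CHAR('a) ^ k"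
proof -
  obtain p k where p: "prime p" "t = p ^ k"
    using primepow_t by (auto simp: primepow_def)
  have "CHAR('a) dvd p ^ k * p ^ k"
    using CHAR_dvd_CARD card_F p by (simp add: power2_eq_square)
  then have "CHAR('a) dvd p"
    using prime_CHAR prime_dvd_mult_iff prime_dvd_power by blast
  then have "CHAR('a) = p"
    using prime_CHAR p(1) by (simp add: primes_dvd_imp_eq)
  then show ?thesis
    using p(2) by blast
qed

lemma frob_add: "(x + y :: 'a) ^ t = x ^ t + y ^ t"
  using t_eq_CHAR_power freshmans_dream'[where ?'a = 'a] prime_CHAR by blast

lemma frob_0 [simp]: "(0::'a) ^ t = 0"
  using t_ge_2 by simp

lemma frob_minus: "(- x :: 'a) ^ t = - (x ^ t)"
  using frob_add[of x "- x"] by (simp add: eq_neg_iff_add_eq_0 add.commute)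

lemma frob_diff: "(x - y :: 'a) ^ t = x ^ t - y ^ t"
  using frob_add[of x "- y"] by (simp add: frob_minus)

lemma frob_sum: "(\<Sum>i\<in>A. f i :: 'a) ^ t = (\<Sum>i\<in>A. f i ^ t)"
  by (induction A rule: infinite_finite_induct) (simp_all add: frob_add)

lemma frob_frob [simp]: "((x::'a) ^ t) ^ t = x"
  using power_CARD_eq_self[of x] by (simp add: card_F power2_eq_square power_mult)

lemma frob_eq_0_iff [simp]: "(x::'a) ^ t = 0 \<longleftrightarrow> x = 0"
  using t_ge_2 by simp

text \<open>The fixed field of the involution \<open>x ^ t\<close>, that is, the subfield of order
  \<open>t\<close>; its order is found in \<open>card_K\<close>.\<close>

definition K :: "'a set" where
  "K = {z. z ^ t = z}"

lemma K_iff: "z \<in> K \<longleftrightarrow> z ^ t = z"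
  by (simp add: K_def)

lemma card_K_le: "card K \<le> t"
  using card_power_add_linear_eq_le[of t "-1::'a" 0] t_ge_2 by (simp add: K_def)

lemma trace_in_K: "x + x ^ t \<in> K"
  by (simp add: K_iff frob_add add.commute)

lemma norm_in_K: "x ^ (t + 1) \<in> K"
  by (simp add: K_iff power_mult_distrib mult.commute)

text \<open>Counting polynomial roots bounds both \<open>K\<close> and every fibre of the trace by
  \<open>t\<close>. The \<open>t * t\<close> field elements fit only if all these bounds are
  equalities, so both claims come out of one squeeze.\<close>

lemma card_K: "card K = t"
  and card_trace_fibre: "z \<in> K \<Longrightarrow> card {x. x + x ^ t = z} = t"
proof -
  have le: "card {a \<in> UNIV. a + a ^ t = b} \<le> t" for b :: 'a
    using card_power_add_linear_eq_le[of t "1::'a" b] t_ge_2 by (simp add: add.commute)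
  have im: "range (\<lambda>x. x + x ^ t) \<subseteq> K"
    using trace_in_K by auto
  have "t * t \<le> card (UNIV::'a set)" "0 < t"
    using t_ge_2 by (auto simp: card_F power2_eq_square)
  note full = card_fibres_full[OF finite finite im this(2) le this(1) card_K_le]
  show "card K = t" and "z \<in> K \<Longrightarrow> card {x. x + x ^ t = z} = t"
    using full(1) full(2)[of z] by simp_all
qed

text \<open>The same squeeze for the norm on nonzero elements: \<open>(t + 1) * (t - 1)\<close> of
  them over at most \<open>t - 1\<close> values, with fibres of at most
  \<open>t + 1\<close>.\<close>

lemma card_norm_fibre:
  assumes "z \<in> K" "z \<noteq> 0"
  shows "card {x. x ^ (t + 1) = z} = t + 1"
proof -
  have le: "card {a \<in> UNIV - {0}. a ^ (t + 1) = b} \<le> t + 1" for b :: 'a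
    by (rule order_trans[OF card_mono card_power_eq_le[of "t + 1" b]]) auto
  have im: "(\<lambda>x. x ^ (t + 1)) ` (UNIV - {0}) \<subseteq> K - {0}"
    using norm_in_K by auto
  have c: "card (UNIV - {0::'a}) = (t + 1) * (t - 1)"
    by (simp add: card_F power2_eq_square algebra_simps)
  have k: "card (K - {0}) \<le> t - 1"
    using card_K by (simp add: K_iff)
  have "card {a \<in> UNIV - {0}. a ^ (t + 1) = z} = t + 1"
    by (rule card_fibres_full(2)[OF _ _ im _ le _ k]) (use assms c in auto)
  moreover have "{a \<in> UNIV - {0}. a ^ (t + 1) = z} = {x. x ^ (t + 1) = z}"
    using assms by auto
  ultimately show ?thesis
    by simp
qed

lemma K_add: "x \<in> K \<Longrightarrow> y \<in> K \<Longrightarrow> x + y \<in> K"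
  and K_minus: "x \<in> K \<Longrightarrow> - x \<in> K"
  and K_divide: "x \<in> K \<Longrightarrow> y \<in> K \<Longrightarrow> x / y \<in> K"
  and K_0: "0 \<in> K" and K_1: "1 \<in> K"
  by (simp_all add: K_iff frob_add power_mult_distrib frob_minus power_divide)

lemma not_all_in_K: "\<exists>w. w \<notin> K"
proof (rule ccontr)
  assume "\<nexists>w. w \<notin> K"
  then have "K = UNIV"
    by auto
  then show False
    using card_K card_F t_ge_2 by (simp add: power2_eq_square)
qed

text \<open>\<open>1\<close> and \<open>w\<close> form a \<open>K\<close>-basis: a collision of
  \<open>x + w * y\<close> would express \<open>w\<close> as a quotient of elements of
  \<open>K\<close>, and the \<open>t * t\<close> distinct sums exhaust the field.\<close>

lemma K_decomp:
  assumes "w \<notin> K"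
  shows "\<exists>x\<in>K. \<exists>y\<in>K. c = x + w * y"
proof -
  have "inj_on (\<lambda>(x, y). x + w * y) (K \<times> K)"
  proof (rule inj_onI, clarsimp)
    fix x y x' y' assume *: "x \<in> K" "y \<in> K" "x' \<in> K" "y' \<in> K" "x + w * y = x' + w * y'"
    have "y = y'"
    proof (rule ccontr)
      assume "y \<noteq> y'"
      with * have "w = (x' + - x) / (y + - y')"
        by (simp add: field_simps)
      moreover have "(x' + - x) / (y + - y') \<in> K"
        using * by (intro K_divide K_add K_minus)
      ultimately show False
        using assms by simp
    qed
    with * show "x = x' \<and> y = y'"
      by simp
  qed
  then have "card ((\<lambda>(x, y). x + w * y) ` (K \<times> K)) = CARD('a)"
    by (simp add: card_image card_cartesian_product card_K card_F power2_eq_square)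
  then have "(\<lambda>(x, y). x + w * y) ` (K \<times> K) = UNIV"
    by (intro card_subset_eq) auto
  then have "c \<in> (\<lambda>(x, y). x + w * y) ` (K \<times> K)"
    by simp
  then show ?thesis
    by auto
qed

end

section \<open>Additive characters\<close>

lemma of_int_mult_closed:
  fixes M :: "'a::ring_1 set"
  assumes M0: "0 \<in> M" and Mdiff: "\<And>x y. x \<in> M \<Longrightarrow> y \<in> M \<Longrightarrow> x - y \<in> M" and "x \<in> M"
  shows "of_int n * x \<in> M"
proof -
  have Muminus: "- x \<in> M" if "x \<in> M" for x
    using Mdiff[OF M0 that] by simp
  have Madd: "x + y \<in> M" if "x \<in> M" "y \<in> M" for x y
    using Mdiff[OF that(1) Muminus[OF that(2)]] by simp
  have Mnat: "of_nat k * x \<in> M" for k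
    using \<open>x \<in> M\<close> by (induction k) (auto simp: M0 Madd distrib_right)
  show ?thesis
    by (cases n rule: int_cases2) (use Mnat Muminus[OF Mnat] in auto)
qed

text \<open>Take \<open>M\<close> maximal among the additive subgroups avoiding \<open>1\<close>.
  For \<open>x\<close> outside \<open>M\<close>, adjoining \<open>x\<close> captures
  \<open>1 = k + m * x\<close> with \<open>m\<close> invertible modulo the characteristic
  \<open>p\<close>, so \<open>x\<close> is congruent to an integer. Thus the quotient by
  \<open>M\<close> is cyclic of order \<open>p\<close>, which is all that a character
  requires.\<close>

lemma exists_maximal_additive_subgroup:
  "\<exists>M :: 'a::{field,finite} set. 0 \<in> M \<and> 1 \<notin> M \<and> (\<forall>x\<in>M. \<forall>y\<in>M. x - y \<in> M) \<and>
     (\<forall>x. \<exists>n::int. x - of_int n \<in> M)"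
proof -
  define G where "G = {M :: 'a set. 0 \<in> M \<and> 1 \<notin> M \<and> (\<forall>x\<in>M. \<forall>y\<in>M. x - y \<in> M)}"
  have "{0} \<in> G" "finite G"
    by (auto simp: G_def)
  then obtain M where M: "M \<in> G" and max: "\<And>M'. M' \<in> G \<Longrightarrow> M \<subseteq> M' \<Longrightarrow> M = M'"
    using finite_has_maximal[of G] by blast
  have M0: "0 \<in> M" and M1: "1 \<notin> M" and Mdiff: "\<And>x y. x \<in> M \<Longrightarrow> y \<in> M \<Longrightarrow> x - y \<in> M"
    using M by (auto simp: G_def)
  have Muminus: "- x \<in> M" if "x \<in> M" for x
    using Mdiff[OF M0 that] by simp
  have Madd: "x + y \<in> M" if "x \<in> M" "y \<in> M" for x y
    using Mdiff[OF that(1) Muminus[OF that(2)]] by simp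
  have Mint: "of_int n * x \<in> M" if "x \<in> M" for n x
    using of_int_mult_closed[OF M0 Mdiff that] .
  have pr: "prime CHAR('a)"
    by (simp add: prime_CHAR_semidom finite_imp_CHAR_pos)
  have "\<exists>n::int. x - of_int n \<in> M" for x
  proof (cases "x \<in> M")
    case True
    then show ?thesis
      by (intro exI[of _ 0]) simp
  next
    case False
    define M' where "M' = {k + of_int m * x | k m. k \<in> M}"
    have "M \<subseteq> M'"
      unfolding M'_def by (auto intro!: exI[of _ "0::int"])
    moreover have "x \<in> M'"
      unfolding M'_def using M0 by (auto intro!: exI[of _ "0"] exI[of _ "1::int"])
    ultimately have "M' \<notin> G"
      using max False by blast
    moreover have "0 \<in> M'"
      using \<open>M \<subseteq> M'\<close> M0 by auto
    moreover have "u - v \<in> M'" if "u \<in> M'" "v \<in> M'" for u v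
    proof -
      obtain k m k' m' where "u = k + of_int m * x" "v = k' + of_int m' * x" "k \<in> M" "k' \<in> M"
        using \<open>u \<in> M'\<close> \<open>v \<in> M'\<close> by (auto simp: M'_def)
      then have "u - v = (k - k') + of_int (m - m') * x" "k - k' \<in> M"
        by (auto simp: algebra_simps Mdiff)
      then show ?thesis
        unfolding M'_def by blast
    qed
    ultimately have "1 \<in> M'"
      by (auto simp: G_def)
    then obtain k m where km: "k \<in> M" "1 = k + of_int m * x"
      by (auto simp: M'_def)
    have "(of_int m :: 'a) \<noteq> 0"
      using km M1 by auto
    then have "\<not> int CHAR('a) dvd m"
      using of_int_eq_0_iff_char_dvd by blast
    then have "coprime (int CHAR('a)) m"
      using pr by (intro prime_imp_coprime) auto
    then have "coprime m (int CHAR('a))"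
      by (simp add: coprime_commute)
    then obtain m' where "[m * m' = 1] (mod int CHAR('a))"
      using coprime_iff_invertible_int by auto
    then have inv: "(of_int m * of_int m' :: 'a) = 1"
      by (metis of_int_eq_iff_cong_CHAR of_int_mult of_int_1)
    have "of_int m' = of_int m' * k + x * (of_int m * of_int m')"
      by (subst mult_1_right[symmetric], subst km(2)) (simp add: algebra_simps)
    then have "of_int m' * k + x = of_int m'"
      by (simp only: inv mult_1_right)
    then have "x - of_int m' = - (of_int m' * k)"
      by (metis add_diff_cancel_left' diff_add_cancel minus_diff_eq)
    then show ?thesis
      using Mint[OF km(1)] Muminus by metis
  qed
  then show ?thesis
    using M0 M1 Mdiff by blast
qed

text \<open>Send \<open>x\<close> to the \<open>p\<close>-th root of unity with exponent
  \<open>N x\<close>, an integer congruent to \<open>x\<close> modulo \<open>M\<close>. Integers in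
  \<open>M\<close> are multiples of \<open>p\<close>, so the choice of \<open>N x\<close> does not
  matter and the map is multiplicative; it is nontrivial at \<open>1\<close> because
  \<open>1\<close> is not in \<open>M\<close>.\<close>

lemma exists_additive_character:
  "\<exists>\<psi> :: 'a::{field,finite} \<Rightarrow> complex.
     (\<forall>x y. \<psi> (x + y) = \<psi> x * \<psi> y) \<and> (\<forall>x. norm (\<psi> x) = 1) \<and> (\<exists>x. \<psi> x \<noteq> 1)"
proof -
  obtain M :: "'a set" where M0: "0 \<in> M" and M1: "1 \<notin> M"
    and Mdiff: "\<And>x y. x \<in> M \<Longrightarrow> y \<in> M \<Longrightarrow> x - y \<in> M"
    and ex: "\<And>x. \<exists>n::int. x - of_int n \<in> M"
    using exists_maximal_additive_subgroup[where ?'a = 'a] by blast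
  have Muminus: "- x \<in> M" if "x \<in> M" for x
    using Mdiff[OF M0 that] by simp
  have Madd: "x + y \<in> M" if "x \<in> M" "y \<in> M" for x y
    using Mdiff[OF that(1) Muminus[OF that(2)]] by simp
  define p where "p = int CHAR('a)"
  have pr: "prime p"
    by (simp add: p_def prime_CHAR_semidom finite_imp_CHAR_pos)
  define N where "N x = (SOME n::int. x - of_int n \<in> M)" for x
  have N: "x - of_int (N x) \<in> M" for x
    unfolding N_def by (rule someI_ex) (rule ex)
  have Mint: "of_int n * x \<in> M" if "x \<in> M" for n x
    using of_int_mult_closed[OF M0 Mdiff that] .
  have dvd: "p dvd n" if "of_int n \<in> M" for n
  proof (rule ccontr)
    assume "\<not> p dvd n"
    then have "coprime p n"
      using pr by (intro prime_imp_coprime)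
    then have "coprime n p"
      by (simp add: coprime_commute)
    then obtain m where "[n * m = 1] (mod p)"
      using coprime_iff_invertible_int by auto
    then have "(of_int m * of_int n :: 'a) = 1"
      unfolding p_def by (metis of_int_eq_iff_cong_CHAR of_int_mult of_int_1 mult.commute)
    then show False
      using Mint[OF that, of m] M1 by simp
  qed
  define \<psi> where "\<psi> x = cis (2 * pi * (of_int (N x) / of_int p))" for x
  have cis_dvd: "cis (2 * pi * (of_int n / of_int p)) = 1" if "p dvd n" for n
  proof -
    from that obtain k where "n = p * k" ..
    then have "of_int n / of_int p = (of_int k :: real)"
      using pr by auto
    then show ?thesis
      by simp
  qed
  have add: "\<psi> (x + y) = \<psi> x * \<psi> y" for x y
  proof -
    have "(x - of_int (N x)) + (y - of_int (N y)) - (x + y - of_int (N (x + y))) \<in> M"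
      by (intro Mdiff Madd N)
    then have "of_int (N (x + y) - N x - N y) \<in> M"
      by (simp add: algebra_simps)
    then have "cis (2 * pi * (of_int (N (x + y) - N x - N y) / of_int p)) = 1"
      by (intro cis_dvd dvd)
    then have "\<psi> x * \<psi> y = \<psi> x * \<psi> y * cis (2 * pi * (of_int (N (x + y) - N x - N y) / of_int p))"
      by simp
    also have "\<dots> = \<psi> (x + y)"
      unfolding \<psi>_def cis_mult
      by (rule arg_cong[of _ _ cis]) (simp add: diff_divide_distrib add_divide_distrib algebra_simps)
    finally show ?thesis ..
  qed
  have "\<psi> 1 \<noteq> 1"
  proof
    assume "\<psi> 1 = 1"
    then obtain k :: int where "2 * pi * (of_int (N 1) / of_int p) = of_int k * (2 * pi)"
      unfolding \<psi>_def cis_eq_1_iff by blast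
    then have "of_int (N 1) = (of_int (k * p) :: real)"
      using pr by (auto simp: field_simps)
    then have "N 1 = k * p"
      by linarith
    then have "(of_int (N 1) :: 'a) = 0"
      by (simp add: p_def)
    then show False
      using N[of 1] M1 by simp
  qed
  then show ?thesis
    using add by (intro exI[of _ \<psi>]) (auto simp: \<psi>_def)
qed

text \<open>The last assumption makes \<open>\<psi>\<close> factor through the trace. This yields
  invariance under \<open>x ^ t\<close> and lets sums with the hermitian form depend on the trace of
  \<open>\<theta>\<close> only.\<close>

locale invariant_character = quadratic_extension t F
  for t :: nat and F :: "'a::{field,finite} itself" +
  fixes \<psi> :: "'a \<Rightarrow> complex"
  assumes char_add: "\<psi> (x + y) = \<psi> x * \<psi> y"
    and norm_char [simp]: "norm (\<psi> x) = 1"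
    and char_nontrivial: "\<exists>x. \<psi> x \<noteq> 1"
    and char_trace_0: "x + x ^ t = 0 \<Longrightarrow> \<psi> x = 1"

lemma (in quadratic_extension) exists_invariant_character:
  "\<exists>\<psi> :: 'a \<Rightarrow> complex. invariant_character t \<psi>"
proof -
  obtain \<phi> :: "'a \<Rightarrow> complex" and c where
    \<phi>: "\<And>x y. \<phi> (x + y) = \<phi> x * \<phi> y" "\<And>x. norm (\<phi> x) = 1" "\<phi> c \<noteq> 1"
    using exists_additive_character[where ?'a = 'a] by blast
  have "K \<noteq> {0}"
    using card_K t_ge_2 by auto
  then obtain k where k: "k \<in> K" "k \<noteq> 0"
    using K_0 by auto
  then have "card {x. x + x ^ t = k} > 0"
    using card_trace_fibre t_ge_2 by simp
  then obtain z where z: "z + z ^ t = k"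
    by (auto simp: card_gt_0_iff)
  \<comment> \<open>The factor \<open>c / k\<close> is chosen so that \<open>z\<close>, of trace
    \<open>k\<close>, has the value \<open>\<phi> c\<close>, which differs from 1.\<close>
  define \<psi> where "\<psi> x = \<phi> (c / k * (x + x ^ t))" for x
  have "invariant_character t \<psi>"
  proof
    show "\<psi> (x + y) = \<psi> x * \<psi> y" for x y
      unfolding \<psi>_def \<phi>(1)[symmetric] by (simp add: frob_add algebra_simps)
    show "\<exists>x. \<psi> x \<noteq> 1"
      by (rule exI[of _ z]) (use z k \<phi>(3) in \<open>auto simp: \<psi>_def\<close>)
    show "\<psi> x = 1" if "x + x ^ t = 0" for x
    proof -
      have "\<phi> 0 \<noteq> 0"
        using \<phi>(2)[of 0] by force
      then show ?thesis
        using that \<phi>(1)[of 0 0] by (simp add: \<psi>_def)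
    qed
  qed (simp_all add: \<psi>_def \<phi>(2))
  then show ?thesis
    by blast
qed

context invariant_character
begin

lemma char_0 [simp]: "\<psi> 0 = 1"
proof -
  have "\<psi> 0 \<noteq> 0"
    using norm_char[of 0] by force
  then show ?thesis
    using char_add[of 0 0] by simp
qed

lemma char_frob: "\<psi> (x ^ t) = \<psi> x"
proof -
  have "\<psi> (x ^ t - x) = 1"
    by (rule char_trace_0) (simp add: frob_diff)
  then show ?thesis
    using char_add[of "x ^ t - x" x] by simp
qed

lemma char_sum: "(\<Sum>x\<in>UNIV. \<psi> (b * x)) = (if b = 0 then of_nat (t\<^sup>2) else 0)"
proof (cases "b = 0")
  case False
  obtain c where c: "\<psi> c \<noteq> 1"
    using char_nontrivial by blast
  have "(\<Sum>x\<in>UNIV. \<psi> (b * x)) = (\<Sum>x\<in>UNIV. \<psi> (b * (x + c / b)))"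
    by (rule sum.reindex_bij_witness[of _ "\<lambda>x. x + c / b" "\<lambda>x. x - c / b"]) auto
  also have "\<dots> = \<psi> c * (\<Sum>x\<in>UNIV. \<psi> (b * x))"
    using False by (simp add: distrib_left char_add sum_distrib_left mult.commute)
  finally show ?thesis
    using False c by auto
qed (simp add: card_F)

end

section \<open>Subspaces over a finite field\<close>

lemma card_subspace_kernel:
  fixes W :: "('a::{field,finite} ^ 'n::finite) set" and \<phi> :: "'a ^ 'n \<Rightarrow> 'a"
  assumes W: "vec.subspace W" and u: "u \<in> W" "\<phi> u \<noteq> 0"
    and add: "\<And>x y. \<phi> (x + y) = \<phi> x + \<phi> y" and scale: "\<And>c x. \<phi> (c *s x) = c * \<phi> x"
  shows "card W = CARD('a) * card {x \<in> W. \<phi> x = 0}"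
proof -
  have neg: "\<phi> (x - c *s u) = \<phi> x - c * \<phi> u" for x c
    using add[of "x - c *s u" "c *s u"] scale by (simp add: algebra_simps)
  have "bij_betw (\<lambda>(c, x). x + c *s u) (UNIV \<times> {x \<in> W. \<phi> x = 0}) W"
    by (rule bij_betw_byWitness[of _ "\<lambda>x. (\<phi> x / \<phi> u, x - (\<phi> x / \<phi> u) *s u)"])
      (use W u in \<open>auto simp: add scale neg intro: vec.subspace_add vec.subspace_diff vec.subspace_scale\<close>)
  from bij_betw_same_card[OF this] show ?thesis
    by (simp add: card_cartesian_product)
qed

lemma card_subspace_extend:
  fixes W :: "('a::{field,finite} ^ 'n::finite) set"
  assumes W: "vec.subspace W" and u: "u \<notin> W"
  shows "card {x + c *s u | x c. x \<in> W} = CARD('a) * card W"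
proof -
  have "inj_on (\<lambda>(c, x). x + c *s u) (UNIV \<times> W)"
  proof (rule inj_onI, clarsimp)
    fix c x c' x' assume *: "x \<in> W" "x' \<in> W" "x + c *s u = x' + c' *s u"
    have "c = c'"
    proof (rule ccontr)
      assume "c \<noteq> c'"
      have "(c - c') *s u = x' - x"
        using *(3) by (simp add: vec.scale_left_diff_distrib algebra_simps)
      then have "(1 / (c - c')) *s ((c - c') *s u) = (1 / (c - c')) *s (x' - x)"
        by simp
      then have "u = (1 / (c - c')) *s (x' - x)"
        using \<open>c \<noteq> c'\<close> by (simp add: vector_smult_assoc)
      moreover have "(1 / (c - c')) *s (x' - x) \<in> W"
        using * W by (intro vec.subspace_scale vec.subspace_diff)
      ultimately show False
        using u by simp
    qed
    with * show "c = c' \<and> x = x'"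
      by simp
  qed
  from card_image[OF this] have "card ((\<lambda>(c, x). x + c *s u) ` (UNIV \<times> W)) = CARD('a) * card W"
    by (simp add: card_cartesian_product)
  moreover have "(\<lambda>(c, x). x + c *s u) ` (UNIV \<times> W) = {x + c *s u | x c. x \<in> W}"
    by auto
  ultimately show ?thesis
    by simp
qed

lemma subspace_extend:
  fixes W :: "('a::field ^ 'n::finite) set"
  assumes W: "vec.subspace W"
  shows "vec.subspace {x + c *s u | x c. x \<in> W}"
proof (rule vec.subspaceI)
  show "0 \<in> {x + c *s u | x c. x \<in> W}"
    using vec.subspace_0[OF W] by (auto intro!: exI[of _ 0])
next
  fix x y assume "x \<in> {x + c *s u | x c. x \<in> W}" "y \<in> {x + c *s u | x c. x \<in> W}"
  then obtain x' c y' d where "x = x' + c *s u" "x' \<in> W" "y = y' + d *s u" "y' \<in> W"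
    by auto
  then have "x + y = (x' + y') + (c + d) *s u" "x' + y' \<in> W"
    using W by (auto simp: vec.scale_left_distrib algebra_simps vec.subspace_add)
  then show "x + y \<in> {x + c *s u | x c. x \<in> W}"
    by blast
next
  fix k x assume "x \<in> {x + c *s u | x c. x \<in> W}"
  then obtain x' c where "x = x' + c *s u" "x' \<in> W"
    by auto
  then have "k *s x = k *s x' + (k * c) *s u" "k *s x' \<in> W"
    using W by (auto simp: vec.scale_right_distrib vector_smult_assoc vec.subspace_scale)
  then show "k *s x \<in> {x + c *s u | x c. x \<in> W}"
    by blast
qed

lemma card_subspace:
  fixes W :: "('a::{field,finite} ^ 'n::finite) set"
  assumes "vec.subspace W"
  shows "card W = CARD('a) ^ vec.dim W"
proof -
  obtain B where B: "B \<subseteq> W" "vec.independent B" "W \<subseteq> vec.span B" "card B = vec.dim W"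
    using vec.basis_exists by blast
  have "card (vec.span B) = CARD('a) ^ card B" if "vec.independent B" for B :: "('a ^ 'n) set"
    using finite[of B] that
  proof (induction B rule: finite_induct)
    case (insert b B)
    have b: "b \<notin> vec.span B"
      using insert by (simp add: vec.independent_insert)
    have "vec.span (insert b B) = {x + c *s b | x c. x \<in> vec.span B}"
      by (auto simp: vec.span_insert) (metis diff_add_cancel, metis add_diff_cancel_right')
    then show ?case
      using card_subspace_extend[OF vec.subspace_span b] insert
      by (simp add: vec.independent_insert)
  qed simp
  moreover have "vec.span B = W"
    using B assms by (metis subset_antisym vec.span_minimal)
  ultimately show ?thesis
    using B by metis
qed

lemma one_less_CARD_field: "1 < CARD('a::{field,finite})"
proof -
  have "card {0, 1::'a} \<le> CARD('a)"
    by (intro card_mono) auto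
  then show ?thesis
    by simp
qed

lemma card_proper_subspace:
  fixes W :: "('a::{field,finite} ^ 'n::finite) set"
  assumes W: "vec.subspace W" and lt: "card W < CARD('a) ^ k"
  shows "card W * CARD('a) \<le> CARD('a) ^ k"
proof -
  have "vec.dim W < k"
    using lt one_less_CARD_field[where ?'a = 'a] by (simp add: card_subspace[OF W])
  then have "CARD('a) ^ Suc (vec.dim W) \<le> CARD('a) ^ k"
    using one_less_CARD_field[where ?'a = 'a] by (intro power_increasing) auto
  then show ?thesis
    by (simp add: card_subspace[OF W] mult.commute)
qed

lemma card_kernel_image:
  fixes g :: "'a::{finite,ab_group_add} \<Rightarrow> 'b::{finite,ab_group_add}"
  assumes add: "\<And>x y. g (x + y) = g x + g y"
  shows "CARD('a) = card (range g) * card {x. g x = 0}"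
proof -
  have "CARD('a) = (\<Sum>y\<in>range g. card {x. g x = y})"
    using sum.group[of UNIV "range g" g "\<lambda>_. 1::nat"] by simp
  also have "\<dots> = (\<Sum>y\<in>range g. card {x. g x = 0})"
  proof (rule sum.cong[OF refl])
    fix y assume "y \<in> range g"
    then obtain z where z: "y = g z"
      by blast
    have "g (x - z) = g x - g z" for x
      using add[of "x - z" z] by (simp add: algebra_simps)
    then have "bij_betw (\<lambda>x. x + z) {x. g x = 0} {x. g x = y}"
      by (intro bij_betw_byWitness[of _ "\<lambda>x. x - z"]) (auto simp: z add)
    then show "card {x. g x = y} = card {x. g x = 0}"
      by (metis bij_betw_same_card)
  qed
  finally show ?thesis
    by simp
qed

section \<open>The hermitian form and its orthogonal hyperplanes\<close>

context quadratic_extension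
begin

definition herm :: "'a ^ 'n::finite \<Rightarrow> 'a ^ 'n \<Rightarrow> 'a" where
  "herm x y = (\<Sum>i\<in>UNIV. x $ i * (y $ i) ^ t)"

lemma herm_add_left: "herm (x + y) z = herm x z + herm y z"
  by (simp add: herm_def distrib_right sum.distrib)

lemma herm_add_right: "herm z (x + y) = herm z x + herm z y"
  by (simp add: herm_def distrib_left sum.distrib frob_add)

lemma herm_scale_left: "herm (c *s x) y = c * herm x y"
  by (simp add: herm_def sum_distrib_left mult.assoc)

lemma herm_scale_right: "herm x (c *s y) = c ^ t * herm x y"
  by (simp add: herm_def sum_distrib_left power_mult_distrib mult_ac)

lemma herm_0_left [simp]: "herm 0 x = 0" and herm_0_right [simp]: "herm x 0 = 0"
  by (simp_all add: herm_def)

lemma herm_diff_left: "herm (x - y) z = herm x z - herm y z"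
  using herm_add_left[of "x - y" y z] by (simp add: algebra_simps)

lemma herm_diff_right: "herm z (x - y) = herm z x - herm z y"
  using herm_add_right[of z "x - y" y] by (simp add: algebra_simps)

lemma herm_conj: "herm x y ^ t = herm y x"
  by (simp add: herm_def frob_sum power_mult_distrib mult.commute)

lemma herm_eq_0_commute: "herm x y = 0 \<longleftrightarrow> herm y x = 0"
  by (metis herm_conj frob_eq_0_iff)

lemma herm_self_in_K: "herm x x \<in> K"
  by (simp add: K_iff herm_conj)

lemma herm_axis: "herm (axis i c) x = c * (x $ i) ^ t"
  by (simp add: herm_def axis_def if_distrib[of "\<lambda>z. z * _"] cong: if_cong)

lemma herm_nondegenerate: "(\<And>x. herm x a = 0) \<Longrightarrow> a = 0"
  by (metis herm_axis mult_1 frob_eq_0_iff vec_eq_iff zero_index)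

lemma herm_nonzero_witness:
  assumes "a \<noteq> 0" shows "\<exists>x. herm x a \<noteq> 0"
  using herm_nondegenerate assms by blast

lemma herm_unit_witness:
  assumes "a \<noteq> 0" shows "\<exists>x. herm x a = 1"
proof -
  obtain x where "herm x a \<noteq> 0"
    using herm_nonzero_witness[OF assms] by blast
  then have "herm ((1 / herm x a) *s x) a = 1"
    by (simp add: herm_scale_left)
  then show ?thesis ..
qed

definition perp :: "('a ^ 'n::finite) set \<Rightarrow> 'a ^ 'n \<Rightarrow> ('a ^ 'n) set" where
  "perp W a = {x \<in> W. herm x a = 0}"

lemma subspace_perp: "vec.subspace W \<Longrightarrow> vec.subspace (perp W a)"
  unfolding perp_def
  by (rule vec.subspaceI)
    (auto simp: herm_add_left herm_scale_left vec.subspace_0 vec.subspace_add vec.subspace_scale)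

lemma card_perp:
  assumes "vec.subspace W" "u \<in> W" "herm u a \<noteq> 0"
  shows "card W = t\<^sup>2 * card (perp W a)"
  using card_subspace_kernel[of W u "\<lambda>x. herm x a"] assms
  by (simp add: herm_add_left herm_scale_left perp_def card_F)

text \<open>Pairing with a basis of \<open>W\<close> sends the vectors \<open>a\<close> to tuples of
  length \<open>dim W\<close>. There are fewer tuples than vectors, so two vectors share a tuple,
  and their difference is orthogonal to \<open>W\<close>.\<close>

lemma subspace_perp_exists:
  fixes W :: "('a ^ 'n::finite) set"
  assumes W: "vec.subspace W" and "W \<noteq> UNIV"
  shows "\<exists>a. a \<noteq> 0 \<and> (\<forall>x\<in>W. herm x a = 0)"
proof -
  obtain B where B: "B \<subseteq> W" "vec.independent B" "W \<subseteq> vec.span B" "card B = vec.dim W"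
    using vec.basis_exists by blast
  define g where "g a = (\<lambda>b\<in>B. herm b a)" for a
  have "card W < CARD('a ^ 'n)"
    using assms(2) by (intro psubset_card_mono) auto
  then have less: "vec.dim W < CARD('n)"
    using one_less_CARD_field[where ?'a = 'a] by (simp add: card_subspace[OF W])
  have "\<not> inj g"
  proof
    assume "inj g"
    then have "CARD('a ^ 'n) \<le> card (B \<rightarrow>\<^sub>E (UNIV::'a set))"
      by (intro card_inj_on_le[of g]) (auto simp: g_def)
    also have "\<dots> = CARD('a) ^ vec.dim W"
      by (simp add: card_funcsetE B(4))
    finally show False
      using less one_less_CARD_field[where ?'a = 'a] by simp
  qed
  then obtain a b where ab: "g a = g b" "a \<noteq> b"
    by (auto simp: inj_def)
  have "herm x (a - b) = 0" if "x \<in> B" for x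
    using ab(1) that by (auto simp: g_def herm_diff_right dest!: fun_cong[of _ _ x])
  then have "B \<subseteq> perp UNIV (a - b)"
    by (auto simp: perp_def)
  then have "vec.span B \<subseteq> perp UNIV (a - b)"
    by (intro vec.span_minimal subspace_perp vec.subspace_UNIV)
  then show ?thesis
    using B(3) ab(2) by (intro exI[of _ "a - b"]) (auto simp: perp_def)
qed

end

section \<open>Hermitian forms on subspaces\<close>

context quadratic_extension
begin

definition isotropic_card :: "('a ^ 'n::finite) set \<Rightarrow> nat" where
  "isotropic_card W = card {x \<in> W. herm x x = 0}"

lemma herm_add_scale_self:
  "herm (x + c *s a) (x + c *s a) = herm x x + (c * herm a x + (c * herm a x) ^ t) + c ^ (t + 1) * herm a a"
  by (simp add: herm_add_left herm_add_right herm_scale_left herm_scale_right power_mult_distrib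
      herm_conj algebra_simps)

text \<open>\<open>W\<close> is the direct sum of \<open>perp W a\<close> and the line of
  \<open>a\<close>. Above an isotropic \<open>y\<close> only \<open>c = 0\<close> makes
  \<open>y + c *s a\<close> isotropic; above any other \<open>y\<close> exactly \<open>t + 1\<close>
  values of \<open>c\<close> do, by the norm fibres.\<close>

lemma isotropic_card_perp_anisotropic:
  fixes W :: "('a ^ 'n::finite) set"
  assumes W: "vec.subspace W" and a: "a \<in> W" "herm a a \<noteq> 0"
  shows "isotropic_card W + t * isotropic_card (perp W a) = (t + 1) * card (perp W a)"
proof -
  let ?P = "perp W a"
  define C where "C y = {c. c ^ (t + 1) = - herm y y / herm a a}" for y :: "'a ^ 'n"
  have cC: "card (C y) = (if herm y y = 0 then 1 else t + 1)" for y
  proof (cases "herm y y = 0")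
    case True
    then have "C y = {0}"
      by (auto simp: C_def)
    with True show ?thesis
      by simp
  next
    case False
    then show ?thesis
      unfolding C_def using a(2)
      by (subst card_norm_fibre) (auto intro!: K_divide K_minus herm_self_in_K)
  qed
  have P: "herm y a = 0" "herm a y = 0" if "y \<in> ?P" for y
    using that herm_eq_0_commute by (auto simp: perp_def)
  have "bij_betw (\<lambda>(y, c). y + c *s a) (SIGMA y:?P. C y) {x \<in> W. herm x x = 0}"
  proof (rule bij_betw_byWitness[of _ "\<lambda>x. (x - (herm x a / herm a a) *s a, herm x a / herm a a)"])
    show "\<forall>p\<in>SIGMA y:?P. C y. (\<lambda>x. (x - (herm x a / herm a a) *s a, herm x a / herm a a))
        ((\<lambda>(y, c). y + c *s a) p) = p"
      using a(2) by (auto simp: herm_add_left herm_scale_left P)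
    show "\<forall>x\<in>{x \<in> W. herm x x = 0}. (\<lambda>(y, c). y + c *s a)
        (x - (herm x a / herm a a) *s a, herm x a / herm a a) = x"
      by auto
    show "(\<lambda>(y, c). y + c *s a) ` (SIGMA y:?P. C y) \<subseteq> {x \<in> W. herm x x = 0}"
    proof clarify
      fix y c assume y: "y \<in> ?P" "c \<in> C y"
      have "y + c *s a \<in> W"
        using W a y(1) by (auto simp: perp_def intro: vec.subspace_add vec.subspace_scale)
      moreover have "c ^ (t + 1) * herm a a = - herm y y"
        using y(2) a(2) by (simp add: C_def del: power_Suc)
      then have "herm (y + c *s a) (y + c *s a) = 0"
        by (simp only: herm_add_scale_self P[OF y(1)]) simp
      ultimately show "y + c *s a \<in> W \<and> herm (y + c *s a) (y + c *s a) = 0"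
        by simp
    qed
    show "(\<lambda>x. (x - (herm x a / herm a a) *s a, herm x a / herm a a)) ` {x \<in> W. herm x x = 0}
        \<subseteq> (SIGMA y:?P. C y)"
    proof clarify
      fix x assume x: "x \<in> W" "herm x x = 0"
      define c where "c = herm x a / herm a a"
      define y where "y = x - c *s a"
      have y: "y \<in> ?P"
        unfolding y_def perp_def using W a x
        by (auto simp: herm_diff_left herm_scale_left c_def intro: vec.subspace_diff vec.subspace_scale)
      have "x = y + c *s a"
        by (simp add: y_def)
      then have "c ^ (t + 1) * herm a a = - herm y y"
        using herm_add_scale_self[of y c a] x(2) P[OF y] by (simp add: eq_neg_iff_add_eq_0 add.commute)
      then have "c \<in> C y"
        using a(2) by (simp add: C_def field_simps)
      with y show "x - (herm x a / herm a a) *s a \<in> ?P \<and>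
          herm x a / herm a a \<in> C (x - (herm x a / herm a a) *s a)"
        by (simp add: y_def c_def)
    qed
  qed
  from bij_betw_same_card[OF this] have "isotropic_card W = (\<Sum>y\<in>?P. card (C y))"
    by (simp add: isotropic_card_def)
  also have "\<dots> = card {y \<in> ?P. herm y y = 0} + (t + 1) * card {y \<in> ?P. herm y y \<noteq> 0}"
    by (simp add: cC sum.If_cases Int_def Collect_conj_eq[symmetric] conj_commute)
  also have "card ?P = card {y \<in> ?P. herm y y = 0} + card {y \<in> ?P. herm y y \<noteq> 0}"
    by (subst card_Un_disjoint[symmetric]) (auto intro: arg_cong[of _ _ card])
  ultimately show ?thesis
    by (simp add: isotropic_card_def algebra_simps)
qed

text \<open>Off \<open>perp W a\<close>, moving along \<open>x + s *s a\<close> changes the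
  hermitian value by the trace of \<open>s * herm a x\<close>. So exactly \<open>t\<close> of the
  \<open>t\<^sup>2\<close> values of \<open>s\<close> give an isotropic vector, and one in
  \<open>t\<close> of the vectors outside \<open>perp W a\<close> is isotropic.\<close>

lemma isotropic_card_perp_isotropic:
  fixes W :: "('a ^ 'n::finite) set"
  assumes W: "vec.subspace W" and a: "a \<in> W" "herm a a = 0" and w: "w \<in> W" "herm w a \<noteq> 0"
  shows "t * isotropic_card W + card (perp W a) = t * isotropic_card (perp W a) + card W"
proof -
  let ?P = "perp W a"
  define S where "S x = {s. herm (x + s *s a) (x + s *s a) = 0}" for x
  have cS: "card (S x) = t" if "x \<in> W - ?P" for x
  proof -
    have nz: "herm a x \<noteq> 0"
      using that herm_eq_0_commute by (auto simp: perp_def)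
    have "bij_betw (\<lambda>s. s * herm a x) (S x) {u. u + u ^ t = - herm x x}"
      by (rule bij_betw_byWitness[of _ "\<lambda>u. u / herm a x"])
        (use nz in \<open>auto simp: S_def herm_add_scale_self a(2) eq_neg_iff_add_eq_0 add_ac\<close>)
    from bij_betw_same_card[OF this] show ?thesis
      by (simp add: card_trace_fibre K_minus herm_self_in_K)
  qed
  have "bij_betw (\<lambda>(x, s). (x + s *s a, s)) (SIGMA x:W - ?P. S x) ({x \<in> W - ?P. herm x x = 0} \<times> UNIV)"
    by (rule bij_betw_byWitness[of _ "\<lambda>(x, s). (x - s *s a, s)"])
      (use W a in \<open>auto simp: S_def perp_def herm_add_left herm_diff_left herm_scale_left
         intro: vec.subspace_add vec.subspace_scale vec.subspace_diff\<close>)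
  from bij_betw_same_card[OF this]
  have "card (W - ?P) * t = card {x \<in> W - ?P. herm x x = 0} * t\<^sup>2"
    by (simp add: cS card_F card_cartesian_product)
  then have "card (W - ?P) = card {x \<in> W - ?P. herm x x = 0} * t"
    using t_ge_2 by (simp add: power2_eq_square)
  moreover have "card W = card ?P + card (W - ?P)"
    by (subst card_Un_disjoint[symmetric]) (auto simp: perp_def intro: arg_cong[of _ _ card])
  moreover have "isotropic_card W = isotropic_card ?P + card {x \<in> W - ?P. herm x x = 0}"
    unfolding isotropic_card_def
    by (subst card_Un_disjoint[symmetric]) (auto simp: perp_def intro: arg_cong[of _ _ card])
  ultimately show ?thesis
    by (simp add: algebra_simps)
qed

text \<open>Each added coordinate splits off an anisotropic unit vector, which gives a recurrence.
  Multiplying by \<open>t\<close> avoids the exponents \<open>2 * k - 1\<close> and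
  \<open>k - 1\<close>, which would misbehave for the empty set.\<close>

lemma isotropic_card_coordinate_subspace:
  fixes J :: "'n::finite set"
  shows "vec.subspace {x :: 'a ^ 'n. \<forall>i. i \<notin> J \<longrightarrow> x $ i = 0} \<and>
    card {x :: 'a ^ 'n. \<forall>i. i \<notin> J \<longrightarrow> x $ i = 0} = t ^ (2 * card J) \<and>
    int t * int (isotropic_card {x :: 'a ^ 'n. \<forall>i. i \<notin> J \<longrightarrow> x $ i = 0}) =
      int t ^ (2 * card J) + (- 1) ^ card J * (int t - 1) * int t ^ card J"
  using finite[of J]
proof (induction J rule: finite_induct)
  case empty
  have "{x :: 'a ^ 'n. \<forall>i. i \<notin> {} \<longrightarrow> x $ i = 0} = {0}"
    by (auto simp: vec_eq_iff)
  moreover have "{x \<in> {0 :: 'a ^ 'n}. herm x x = 0} = {0}"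
    by auto
  ultimately show ?case
    by (simp add: isotropic_card_def vec.subspace_def)
next
  case (insert j J)
  define W where "W = {x :: 'a ^ 'n. \<forall>i. i \<notin> insert j J \<longrightarrow> x $ i = 0}"
  define W' where "W' = {x :: 'a ^ 'n. \<forall>i. i \<notin> J \<longrightarrow> x $ i = 0}"
  have sub: "vec.subspace W"
    unfolding W_def by (rule vec.subspaceI) auto
  have aW: "axis j 1 \<in> W"
    by (auto simp: W_def axis_def)
  have haa: "herm (axis j 1) (axis j 1 :: 'a ^ 'n) = 1"
    by (simp add: herm_axis)
  have ha: "herm x (axis j 1) = x $ j" for x :: "'a ^ 'n"
    by (subst herm_conj[symmetric]) (simp add: herm_axis)
  have P: "perp W (axis j 1) = W'"
    using insert(2) by (auto simp: perp_def W_def W'_def ha)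
  have c: "card W = t\<^sup>2 * card W'"
    using card_perp[OF sub aW, of "axis j 1"] haa unfolding P by simp
  have z: "int (isotropic_card W) + int t * int (isotropic_card W') = (int t + 1) * int (card W')"
    using isotropic_card_perp_anisotropic[OF sub aW] haa unfolding P
    by (simp flip: of_nat_mult of_nat_add of_nat_Suc add: algebra_simps)
  have IH: "card W' = t ^ (2 * card J)" "int t * int (isotropic_card W') =
      int t ^ (2 * card J) + (- 1) ^ card J * (int t - 1) * int t ^ card J"
    using insert.IH by (simp_all add: W'_def)
  have "int (isotropic_card W) = (int t + 1) * int t ^ (2 * card J)
      - (int t ^ (2 * card J) + (- 1) ^ card J * (int t - 1) * int t ^ card J)"
    using z IH by simp
  also have "int t * \<dots> =
      int t ^ (2 * card (insert j J)) + (- 1) ^ card (insert j J) * (int t - 1) * int t ^ card (insert j J)"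
    using insert(1,2) by (simp add: algebra_simps)
  finally have "int t * int (isotropic_card W) =
      int t ^ (2 * card (insert j J)) + (- 1) ^ card (insert j J) * (int t - 1) * int t ^ card (insert j J)" .
  then show ?case
    using sub c IH(1) insert(1,2) unfolding W_def by (simp add: power2_eq_square)
qed

lemma isotropic_card_UNIV: "int (isotropic_card (UNIV :: ('a ^ 5) set)) = int t ^ 9 - int t ^ 5 + int t ^ 4"
proof -
  have "int t * int (isotropic_card (UNIV :: ('a ^ 5) set)) = int t ^ 10 - (int t - 1) * int t ^ 5"
    using isotropic_card_coordinate_subspace[of "UNIV :: 5 set"] by (simp add: left_diff_distrib)
  also have "\<dots> = int t * (int t ^ 9 - int t ^ 5 + int t ^ 4)"
    by (simp add: algebra_simps eval_nat_numeral)
  finally show ?thesis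
    using t_ge_2 by simp
qed

lemma card_perp_UNIV:
  fixes a :: "'a ^ 5"
  assumes "a \<noteq> 0"
  shows "card (perp UNIV a) = t ^ 8"
proof -
  obtain x where x: "herm x a \<noteq> 0"
    using herm_nonzero_witness[OF assms] by blast
  have "t\<^sup>2 * t ^ 8 = t\<^sup>2 * card (perp UNIV a)"
    using card_perp[OF vec.subspace_UNIV UNIV_I x] by (simp add: card_F flip: power_mult power_add)
  then show ?thesis
    using t_ge_2 by (subst (asm) mult_left_cancel) auto
qed

text \<open>The count for the whole space is known, so the two identities above are solved for the
  hyperplane. The cases are the tangent and the non-tangent hyperplanes.\<close>

lemma isotropic_card_perp_UNIV:
  fixes a :: "'a ^ 5"
  assumes "a \<noteq> 0"
  shows "int (isotropic_card (perp UNIV a)) =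
    (if herm a a = 0 then int t ^ 7 - int t ^ 5 + int t ^ 4 else int t ^ 7 + int t ^ 4 - int t ^ 3)"
proof (cases "herm a a = 0")
  case True
  obtain x where x: "herm x a \<noteq> 0"
    using herm_nonzero_witness[OF assms] by blast
  have "int (t * isotropic_card (UNIV :: ('a ^ 5) set) + card (perp UNIV a)) =
      int (t * isotropic_card (perp UNIV a) + CARD('a ^ 5))"
    using isotropic_card_perp_isotropic[OF vec.subspace_UNIV UNIV_I True UNIV_I x] by metis
  then have "int t * int (isotropic_card (perp UNIV a)) = int t * (int t ^ 7 - int t ^ 5 + int t ^ 4)"
    by (simp add: isotropic_card_UNIV card_perp_UNIV[OF assms] card_F algebra_simps eval_nat_numeral)
  with True show ?thesis
    using t_ge_2 by simp
next
  case False
  have "int (isotropic_card (UNIV :: ('a ^ 5) set) + t * isotropic_card (perp UNIV a)) =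
      int ((t + 1) * card (perp UNIV a))"
    using isotropic_card_perp_anisotropic[OF vec.subspace_UNIV UNIV_I False] by metis
  then have "int t * int (isotropic_card (perp UNIV a)) = int t * (int t ^ 7 + int t ^ 4 - int t ^ 3)"
    by (simp add: isotropic_card_UNIV card_perp_UNIV[OF assms] card_F algebra_simps eval_nat_numeral)
  with False show ?thesis
    using t_ge_2 by simp
qed

lemma perp_le_imp_dependent:
  assumes "perp UNIV a \<subseteq> perp UNIV b" "a \<noteq> 0"
  shows "\<exists>c. b = c *s a"
proof -
  obtain v where v: "herm v a = 1"
    using herm_unit_witness[OF assms(2)] by blast
  \<comment> \<open>Removing the component \<open>herm x a *s v\<close> puts \<open>x\<close> into
    the hyperplane of \<open>a\<close>, so \<open>herm x b = herm x a * herm v b\<close>.\<close>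
  have "herm x (b - (herm v b) ^ t *s a) = 0" for x
  proof -
    have "x - herm x a *s v \<in> perp UNIV a"
      by (simp add: perp_def herm_diff_left herm_scale_left v)
    then have "herm (x - herm x a *s v) b = 0"
      using assms(1) by (auto simp: perp_def)
    then show ?thesis
      by (simp add: herm_diff_left herm_diff_right herm_scale_left herm_scale_right)
  qed
  then have "b - (herm v b) ^ t *s a = 0"
    by (rule herm_nondegenerate)
  then show ?thesis
    by auto
qed

lemma card_perp_perp:
  fixes a b :: "'a ^ 5"
  assumes "a \<noteq> 0" "\<And>c. b \<noteq> c *s a"
  shows "card (perp (perp UNIV a) b) = t ^ 6"
proof -
  obtain x where x: "x \<in> perp UNIV a" "herm x b \<noteq> 0"
    using perp_le_imp_dependent[of a b] assms by (auto simp: perp_def)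
  have "t\<^sup>2 * card (perp (perp UNIV a) b) = t\<^sup>2 * t ^ 6"
    using card_perp[OF subspace_perp[OF vec.subspace_UNIV] x] card_perp_UNIV[OF assms(1)]
    by (simp flip: power_add)
  then show ?thesis
    using t_ge_2 by (subst (asm) mult_left_cancel) auto
qed

text \<open>Orthogonality puts \<open>b\<close> inside the hyperplane of \<open>a\<close>, so the
  same two identities apply once more within that hyperplane. Other pairs are brought to this
  position by a change of basis of the plane of poles.\<close>

lemma isotropic_card_perp_perp_orthogonal:
  fixes a b :: "'a ^ 5"
  assumes "a \<noteq> 0" and indep: "\<And>c. b \<noteq> c *s a" and orth: "herm b a = 0"
  shows "int (isotropic_card (perp (perp UNIV a) b)) =
    (if herm a a = 0 then
       if herm b b = 0 then int t ^ 4 else int t ^ 5 + int t ^ 4 - int t ^ 3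
     else
       if herm b b = 0 then int t ^ 5 + int t ^ 4 - int t ^ 3 else int t ^ 5 - int t ^ 3 + int t ^ 2)"
proof -
  let ?W = "perp UNIV a"
  note sub = subspace_perp[OF vec.subspace_UNIV, of a]
  have bW: "b \<in> ?W"
    using orth by (simp add: perp_def)
  note cards = card_perp_UNIV[OF assms(1)] card_perp_perp[OF assms(1) indep]
    isotropic_card_perp_UNIV[OF assms(1)]
  show ?thesis
  proof (cases "herm b b = 0")
    case True
    obtain x where x: "x \<in> ?W" "herm x b \<noteq> 0"
      using perp_le_imp_dependent[of a b] assms by (auto simp: perp_def)
    have "int (t * isotropic_card ?W + card (perp ?W b)) =
        int (t * isotropic_card (perp ?W b) + card ?W)"
      using isotropic_card_perp_isotropic[OF sub bW True x] by metis
    then have "int t * int (isotropic_card (perp ?W b)) =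
        int t * int (isotropic_card ?W) + int (card (perp ?W b)) - int (card ?W)"
      by simp
    also have "\<dots> = int t * (if herm a a = 0 then int t ^ 4 else int t ^ 5 + int t ^ 4 - int t ^ 3)"
      by (cases "herm a a = 0") (simp_all add: cards algebra_simps eval_nat_numeral)
    finally have "int t * int (isotropic_card (perp ?W b)) =
        int t * (if herm a a = 0 then int t ^ 4 else int t ^ 5 + int t ^ 4 - int t ^ 3)" .
    with True show ?thesis
      using t_ge_2 by simp
  next
    case False
    have "int (isotropic_card ?W + t * isotropic_card (perp ?W b)) = int ((t + 1) * card (perp ?W b))"
      using isotropic_card_perp_anisotropic[OF sub bW False] by metis
    then have "int t * int (isotropic_card (perp ?W b)) =
        (int t + 1) * int (card (perp ?W b)) - int (isotropic_card ?W)"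
      by (simp add: algebra_simps)
    also have "\<dots> =
        int t * (if herm a a = 0 then int t ^ 5 + int t ^ 4 - int t ^ 3 else int t ^ 5 - int t ^ 3 + int t ^ 2)"
      by (cases "herm a a = 0") (simp_all add: cards algebra_simps eval_nat_numeral)
    finally have "int t * int (isotropic_card (perp ?W b)) =
        int t * (if herm a a = 0 then int t ^ 5 + int t ^ 4 - int t ^ 3 else int t ^ 5 - int t ^ 3 + int t ^ 2)" .
    with False show ?thesis
      using t_ge_2 by simp
  qed
qed

end

section \<open>Sections by pairs of hyperplanes\<close>

context quadratic_extension
begin

definition pair_card :: "'a ^ 5 \<Rightarrow> 'a ^ 5 \<Rightarrow> nat" where
  "pair_card a b = card {x. herm x x = 0 \<and> herm x a * herm x b = 0}"

lemma pair_card_commute: "pair_card a b = pair_card b a"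
  by (simp add: pair_card_def mult.commute)

lemma pair_card_eq:
  "int (pair_card a b) = int (isotropic_card (perp UNIV a)) + int (isotropic_card (perp UNIV b))
     - int (isotropic_card (perp (perp UNIV a) b))"
proof -
  have "{x. herm x x = 0 \<and> herm x a * herm x b = 0} =
      {x \<in> perp UNIV a. herm x x = 0} \<union> {x \<in> perp UNIV b. herm x x = 0}"
    by (auto simp: perp_def)
  moreover have "{x \<in> perp UNIV a. herm x x = 0} \<inter> {x \<in> perp UNIV b. herm x x = 0} =
      {x \<in> perp (perp UNIV a) b. herm x x = 0}"
    by (auto simp: perp_def)
  ultimately show ?thesis
    using card_Un_Int[of "{x \<in> perp UNIV a. herm x x = 0}" "{x \<in> perp UNIV b. herm x x = 0}"]
    by (simp add: pair_card_def isotropic_card_def)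
qed

text \<open>Inside the hyperplane of \<open>a\<close>, the poles \<open>b\<close> and
  \<open>c\<close> cut out the same subspace. Hence \<open>c\<close> determines the codimension 2
  term and \<open>b\<close> the second hyperplane, and these two binary choices produce the four
  largest values.\<close>

lemma pair_card_anisotropic:
  assumes a: "herm a a \<noteq> 0" and c: "c \<noteq> 0" "herm c a = 0" and b: "b = k *s a + c"
  shows "int (pair_card a b) = 1 + (int t ^ 2 - 1) *
    (if herm b b = 0 then
       if herm c c = 0 then 2 * int t ^ 5 + int t ^ 2 + 1 else 2 * int t ^ 5 + 2 * int t ^ 2 + 1
     else
       if herm c c = 0 then 2 * int t ^ 5 + int t ^ 3 + int t ^ 2 + 1
       else 2 * int t ^ 5 + int t ^ 3 + 2 * int t ^ 2 + 1)"
proof -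
  have a0: "a \<noteq> 0"
    using a by auto
  have indep: "c \<noteq> d *s a" for d
    using a c by (auto simp: herm_scale_left)
  have b0: "b \<noteq> 0"
  proof
    assume "b = 0"
    then have "c = (- k) *s a"
      using b by (simp add: eq_neg_iff_add_eq_0 add.commute)
    then show False
      using indep by blast
  qed
  have "perp (perp UNIV a) b = perp (perp UNIV a) c"
    by (auto simp: perp_def b herm_add_right herm_scale_right)
  then show ?thesis
    unfolding pair_card_eq
    by (simp add: isotropic_card_perp_perp_orthogonal[OF a0 indep c(2)] isotropic_card_perp_UNIV a0 b0 a
        algebra_simps eval_nat_numeral)
qed

lemma anisotropic_decomp:
  assumes "herm a a \<noteq> 0" "\<And>d. b \<noteq> d *s a"
  shows "\<exists>k c. c \<noteq> 0 \<and> herm c a = 0 \<and> b = k *s a + c"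
proof -
  let ?k = "herm b a / herm a a"
  have "b - ?k *s a \<noteq> 0"
    using assms(2)[of ?k] by auto
  moreover have "herm (b - ?k *s a) a = 0"
    using assms(1) by (simp add: herm_diff_left herm_scale_left)
  ultimately show ?thesis
    by (intro exI[of _ ?k] exI[of _ "b - ?k *s a"]) simp
qed

lemma exists_trace_nonzero: "\<exists>s :: 'a. s + s ^ t \<noteq> 0"
proof -
  have "card {s :: 'a. s + s ^ t = 0} < CARD('a)"
    using card_trace_fibre[OF K_0] t_ge_2 by (simp add: card_F power2_eq_square)
  then have "{s :: 'a. s + s ^ t = 0} \<noteq> UNIV"
    by auto
  then show ?thesis
    by blast
qed

text \<open>Both poles are isotropic, so neither splits off. An anisotropic \<open>e\<close> in
  their span replaces \<open>a\<close> for the codimension 2 term only. This configuration is the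
  source of the exceptional value \<open>2 * t ^ 5 - t ^ 3 + 2 * t ^ 2 + 1\<close>.\<close>

lemma pair_card_hyperbolic:
  assumes a: "herm a a = 0" and b: "herm b b = 0" and ab: "herm b a \<noteq> 0"
  shows "int (pair_card a b) = 1 + (int t ^ 2 - 1) * (2 * int t ^ 5 - int t ^ 3 + 2 * int t ^ 2 + 1)"
proof -
  have nz: "a \<noteq> 0" "b \<noteq> 0"
    using ab by auto
  obtain u :: 'a where u: "u + u ^ t \<noteq> 0"
    using exists_trace_nonzero by blast
  \<comment> \<open>Then \<open>herm e e\<close> is the trace of \<open>s * herm b a = u\<close>,
    hence nonzero.\<close>
  define s where "s = u / herm b a"
  define e where "e = a + s *s b"
  have e: "herm e e \<noteq> 0"
    using u ab by (simp add: e_def herm_add_scale_self a b s_def)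
  have be: "herm b e = herm b a"
    by (simp add: e_def herm_add_right herm_scale_right b)
  define c where "c = b - (herm b e / herm e e) *s e"
  have ce: "herm c e = 0"
    using e by (simp add: c_def herm_diff_left herm_scale_left)
  have "herm c c = herm c b"
    by (subst (2) c_def) (simp add: herm_diff_right herm_scale_right ce)
  also have "\<dots> = - (herm b e / herm e e) * herm e b"
    by (simp add: c_def herm_diff_left herm_scale_left b)
  finally have cc: "herm c c \<noteq> 0"
    using e be ab herm_eq_0_commute[of b e] by auto
  have c0: "c \<noteq> 0"
    using cc by auto
  have e0: "e \<noteq> 0"
    using e by auto
  have indep: "c \<noteq> d *s e" for d
    using ce e c0 by (auto simp: herm_scale_left)
  have s0: "s \<noteq> 0"
    using u ab by (auto simp: s_def)
  have "perp (perp UNIV a) b = perp (perp UNIV e) b"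
    by (auto simp: perp_def e_def herm_add_right herm_scale_right)
  also have "\<dots> = perp (perp UNIV e) c"
    by (auto simp: perp_def c_def herm_diff_right herm_scale_right)
  finally show ?thesis
    unfolding pair_card_eq
    by (simp add: isotropic_card_perp_perp_orthogonal[OF e0 indep ce] isotropic_card_perp_UNIV nz a b e cc
        algebra_simps eval_nat_numeral)
qed

text \<open>The last two values belong to proportional poles, that is, to a repeated hyperplane; the
  fifth is the hyperbolic pair.\<close>

lemma pair_card_cases:
  assumes "a \<noteq> 0" "b \<noteq> 0"
  shows "\<exists>v. int (pair_card a b) = 1 + (int t ^ 2 - 1) * v \<and>
    v \<in> {2 * int t ^ 5 + int t ^ 3 + 2 * int t ^ 2 + 1, 2 * int t ^ 5 + int t ^ 3 + int t ^ 2 + 1,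
      2 * int t ^ 5 + 2 * int t ^ 2 + 1, 2 * int t ^ 5 + int t ^ 2 + 1,
      2 * int t ^ 5 - int t ^ 3 + 2 * int t ^ 2 + 1,
      int t ^ 5 + int t ^ 3 + int t ^ 2 + 1, int t ^ 5 + int t ^ 2 + 1}"
proof (cases "\<exists>d. b = d *s a")
  case True
  then obtain d where d: "b = d *s a" "d \<noteq> 0"
    using assms by auto
  have "perp (perp UNIV a) b = perp UNIV a" "perp UNIV b = perp UNIV a"
    using d(2) by (auto simp: perp_def d(1) herm_scale_right)
  then show ?thesis
    unfolding pair_card_eq using assms
    by (intro exI[of _ "if herm a a = 0 then int t ^ 5 + int t ^ 2 + 1
        else int t ^ 5 + int t ^ 3 + int t ^ 2 + 1"])
      (simp add: isotropic_card_perp_UNIV algebra_simps eval_nat_numeral)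
next
  case False
  show ?thesis
  proof (cases "herm a a = 0")
    case a: True
    show ?thesis
    proof (cases "herm b b = 0")
      case b: True
      show ?thesis
      proof (cases "herm b a = 0")
        case True
        have "int (pair_card a b) = 1 + (int t ^ 2 - 1) * (2 * int t ^ 5 + int t ^ 2 + 1)"
          unfolding pair_card_eq using False
          by (subst isotropic_card_perp_perp_orthogonal)
            (auto simp: isotropic_card_perp_UNIV assms a b True algebra_simps eval_nat_numeral)
        then show ?thesis
          by blast
      next
        case False
        then show ?thesis
          using pair_card_hyperbolic[OF a b] by blast
      qed
    next
      \<comment> \<open>Only \<open>b\<close> is anisotropic here, so the two poles exchange
        roles.\<close>
      case b: False
      have "a \<noteq> d *s b" for d
      proof
        assume "a = d *s b"
        moreover from this have "d \<noteq> 0"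
          using assms by auto
        ultimately have "b = (1 / d) *s a"
          by (simp add: vector_smult_assoc)
        with False show False
          by blast
      qed
      then obtain k c where "c \<noteq> 0" "herm c b = 0" "a = k *s b + c"
        using anisotropic_decomp[OF b] by blast
      from pair_card_anisotropic[OF b this] a show ?thesis
        by (auto simp: pair_card_commute[of a b])
    qed
  next
    case a: False
    then obtain k c where "c \<noteq> 0" "herm c a = 0" "b = k *s a + c"
      using anisotropic_decomp[OF a] False by blast
    from pair_card_anisotropic[OF a this] show ?thesis
      by auto
  qed
qed

lemma pair_card_values_attained:
  shows "\<exists>a b. a \<noteq> 0 \<and> b \<noteq> 0 \<and> int (pair_card a b) =
      1 + (int t ^ 2 - 1) * (2 * int t ^ 5 + int t ^ 3 + 2 * int t ^ 2 + 1)"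
    and "\<exists>a b. a \<noteq> 0 \<and> b \<noteq> 0 \<and> int (pair_card a b) =
      1 + (int t ^ 2 - 1) * (2 * int t ^ 5 + int t ^ 3 + int t ^ 2 + 1)"
    and "\<exists>a b. a \<noteq> 0 \<and> b \<noteq> 0 \<and> int (pair_card a b) =
      1 + (int t ^ 2 - 1) * (2 * int t ^ 5 + 2 * int t ^ 2 + 1)"
    and "\<exists>a b. a \<noteq> 0 \<and> b \<noteq> 0 \<and> int (pair_card a b) =
      1 + (int t ^ 2 - 1) * (2 * int t ^ 5 + int t ^ 2 + 1)"
proof -
  have "card {x :: 'a. x ^ (t + 1) = - 1} = t + 1"
    by (intro card_norm_fibre K_minus K_1) simp
  then have "{x :: 'a. x ^ (t + 1) = - 1} \<noteq> {}"
    by (metis card.empty Suc_eq_plus1 nat.distinct(1))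
  then obtain w :: 'a where w: "w ^ (t + 1) = - 1"
    by auto
  then have w0: "w \<noteq> 0"
    by auto
  \<comment> \<open>With \<open>w\<close> of norm -1, \<open>n\<close> is isotropic and
    \<open>m\<close> has value -1, both orthogonal to \<open>e1\<close>. Then \<open>e1 + m\<close>
    is isotropic while \<open>e1 + n\<close> is not, so all four combinations for \<open>b\<close>
    and \<open>c\<close> occur.\<close>
  define e1 e2 n m where "e1 = axis (1::5) (1::'a)" and "e2 = axis (2::5) (1::'a)"
    and "n = e2 + axis (3::5) w" and "m = axis (2::5) w"
  note defs = e1_def e2_def n_def m_def
  have ww: "w * w ^ t = - 1"
    using w by simp
  have "0 < t"
    using t_ge_2 by simp
  then have c [simp]: "herm e1 e1 = 1" "herm e2 e2 = 1" "herm n n = 0" "herm e2 e1 = 0" "herm n e1 = 0"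
      "herm m e1 = 0" "herm m m = - 1" "herm (e1 + m) (e1 + m) = 0" "herm (e1 + n) (e1 + n) = 1"
    by (simp_all add: defs herm_add_left herm_add_right herm_axis) (simp_all add: axis_def ww)
  have nz: "e1 \<noteq> 0" "e2 \<noteq> 0" "m \<noteq> 0" "e1 + n \<noteq> 0"
    using c(1,2,7,9) by fastforce+
  have "n $ 2 \<noteq> 0" "(e1 + m) $ 1 \<noteq> 0"
    by (simp_all add: defs axis_def)
  then have nz': "n \<noteq> 0" "e1 + m \<noteq> 0"
    by (metis zero_index)+
  have a: "herm e1 e1 \<noteq> 0"
    by simp
  show "\<exists>a b. a \<noteq> 0 \<and> b \<noteq> 0 \<and> int (pair_card a b) =
      1 + (int t ^ 2 - 1) * (2 * int t ^ 5 + int t ^ 3 + 2 * int t ^ 2 + 1)"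
    using pair_card_anisotropic[OF a, of e2 e2 0] nz by auto
  show "\<exists>a b. a \<noteq> 0 \<and> b \<noteq> 0 \<and> int (pair_card a b) =
      1 + (int t ^ 2 - 1) * (2 * int t ^ 5 + int t ^ 3 + int t ^ 2 + 1)"
    using pair_card_anisotropic[OF a, of n "e1 + n" 1] nz nz' by auto
  show "\<exists>a b. a \<noteq> 0 \<and> b \<noteq> 0 \<and> int (pair_card a b) =
      1 + (int t ^ 2 - 1) * (2 * int t ^ 5 + 2 * int t ^ 2 + 1)"
    using pair_card_anisotropic[OF a, of m "e1 + m" 1] nz nz' by auto
  show "\<exists>a b. a \<noteq> 0 \<and> b \<noteq> 0 \<and> int (pair_card a b) =
      1 + (int t ^ 2 - 1) * (2 * int t ^ 5 + int t ^ 2 + 1)"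
    using pair_card_anisotropic[OF a, of n n 0] nz nz' by auto
qed

end

section \<open>Quadratic forms and their radicals\<close>

definition dot :: "'a::comm_ring_1 ^ 'n::finite \<Rightarrow> 'a ^ 'n \<Rightarrow> 'a" where
  "dot x y = (\<Sum>i\<in>UNIV. x $ i * y $ i)"

definition quad_form :: "'a::field ^ 'n::finite ^ 'n \<Rightarrow> 'a ^ 'n \<Rightarrow> 'a" where
  "quad_form A x = dot x (A *v x)"

definition polar :: "'a::field ^ 'n::finite ^ 'n \<Rightarrow> 'a ^ 'n \<Rightarrow> 'a ^ 'n" where
  "polar A x = (A + transpose A) *v x"

lemma dot_add_left: "dot (x + y) z = dot x z + dot y z"
  and dot_add_right: "dot z (x + y) = dot z x + dot z y"
  and dot_scale_left: "dot (c *s x) y = c * dot x y"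
  and dot_scale_right: "dot x (c *s y) = c * dot x y"
  by (simp_all add: dot_def distrib_left distrib_right sum.distrib sum_distrib_left mult_ac)

lemma dot_0 [simp]: "dot x 0 = 0" "dot 0 x = 0"
  by (simp_all add: dot_def)

lemma dot_axis: "dot (axis i c) x = c * x $ i"
  by (simp add: dot_def axis_def if_distrib[of "\<lambda>z. z * _"] cong: if_cong)

lemma dot_matrix_transpose:
  fixes A :: "'a::field ^ 'n::finite ^ 'n"
  shows "dot x (A *v y) = dot y (transpose A *v x)"
proof -
  have "dot x (A *v y) = (\<Sum>i\<in>UNIV. \<Sum>j\<in>UNIV. x $ i * A $ i $ j * y $ j)"
    by (simp add: dot_def matrix_vector_mult_def sum_distrib_left mult.assoc)
  also have "\<dots> = (\<Sum>j\<in>UNIV. \<Sum>i\<in>UNIV. x $ i * A $ i $ j * y $ j)"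
    by (rule sum.swap)
  also have "\<dots> = dot y (transpose A *v x)"
    by (simp add: dot_def matrix_vector_mult_def transpose_def sum_distrib_left mult_ac)
  finally show ?thesis .
qed

lemma polar_add: "polar A (x + y) = polar A x + polar A y"
  by (simp add: polar_def matrix_vector_right_distrib)

lemma polar_scale: "polar A (c *s x) = c *s polar A x"
  unfolding polar_def by (rule vector_scalar_commute)

lemma polar_0 [simp]: "polar A 0 = 0"
  by (simp add: polar_def)

lemma quad_form_add: "quad_form A (x + y) = quad_form A x + quad_form A y + dot y (polar A x)"
  using dot_matrix_transpose[of x A y]
  by (simp add: quad_form_def polar_def matrix_vector_right_distrib matrix_vector_mult_add_rdistrib
      dot_add_left dot_add_right)

lemma quad_form_scale: "quad_form A (c *s x) = c\<^sup>2 * quad_form A x"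
  by (simp add: quad_form_def vector_scalar_commute dot_scale_left dot_scale_right power2_eq_square)

lemma quad_form_0 [simp]: "quad_form A 0 = 0"
  by (simp add: quad_form_def)

text \<open>In odd characteristic this makes the form vanish on the polar kernel; a kernel vector
  with nonzero value forces characteristic 2.\<close>

lemma dot_polar_self: "dot x (polar A x) = 2 * quad_form A x"
  using dot_matrix_transpose[of x A x]
  by (simp add: quad_form_def polar_def matrix_vector_mult_add_rdistrib dot_add_right)

lemma dot_polar_commute: "dot x (polar A y) = dot y (polar A x)"
  using dot_matrix_transpose[of x A y] dot_matrix_transpose[of y A x]
  by (simp add: polar_def matrix_vector_mult_add_rdistrib dot_add_right)

lemma subspace_polar_kernel: "vec.subspace {x. polar A x = 0}"
  by (rule vec.subspaceI) (auto simp: polar_add polar_scale)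

section \<open>Semilinear radicals over the subfield\<close>

context quadratic_extension
begin

definition frob_vec :: "'a ^ 'n::finite \<Rightarrow> 'a ^ 'n" where
  "frob_vec x = vec_lambda (\<lambda>i. (x $ i) ^ t)"

lemma herm_eq_dot: "herm x y = dot x (frob_vec y)"
  by (simp add: herm_def dot_def frob_vec_def)

lemma frob_vec_add: "frob_vec (x + y) = frob_vec x + frob_vec y"
  and frob_vec_scale: "frob_vec (c *s x) = c ^ t *s frob_vec x"
  and frob_vec_frob_vec [simp]: "frob_vec (frob_vec x) = x"
  and frob_vec_0 [simp]: "frob_vec 0 = 0"
  by (simp_all add: frob_vec_def vec_eq_iff frob_add power_mult_distrib)

lemma frob_vec_eq_0_iff [simp]: "frob_vec x = 0 \<longleftrightarrow> x = 0"
  by (metis frob_vec_frob_vec frob_vec_0)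

text \<open>
  The radical of the \<open>K\<close>-quadratic form underlying \<open>\<tau> herm x x + b quad_form A x\<close>.
\<close>

definition radical :: "'a ^ 'n::finite ^ 'n \<Rightarrow> 'a \<Rightarrow> 'a \<Rightarrow> ('a ^ 'n) set" where
  "radical A \<tau> b = {x. \<tau> *s frob_vec x + b *s polar A x = 0}"

lemma zero_in_radical: "0 \<in> radical A \<tau> b"
  by (simp add: radical_def)

lemma radical_0: "b \<noteq> 0 \<Longrightarrow> radical A 0 b = {x. polar A x = 0}"
  by (simp add: radical_def vec.scale_eq_0_iff)

lemma radical_add: "x \<in> radical A \<tau> b \<Longrightarrow> y \<in> radical A \<tau> b \<Longrightarrow> x + y \<in> radical A \<tau> b"
proof -
  assume "x \<in> radical A \<tau> b" "y \<in> radical A \<tau> b"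
  then have "(\<tau> *s frob_vec x + b *s polar A x) + (\<tau> *s frob_vec y + b *s polar A y) = 0"
    by (simp add: radical_def)
  then show ?thesis
    by (simp add: radical_def frob_vec_add polar_add vec.scale_right_distrib algebra_simps)
qed

lemma radical_scale: "c \<in> K \<Longrightarrow> x \<in> radical A \<tau> b \<Longrightarrow> c *s x \<in> radical A \<tau> b"
proof -
  assume "c \<in> K" "x \<in> radical A \<tau> b"
  then have "\<tau> *s frob_vec (c *s x) + b *s polar A (c *s x) = c *s (\<tau> *s frob_vec x + b *s polar A x)"
    by (simp add: K_iff frob_vec_scale polar_scale vec.scale_right_distrib mult.commute)
  also have "\<dots> = 0"
    using \<open>x \<in> radical A \<tau> b\<close> by (simp add: radical_def)
  finally show ?thesis
    by (simp add: radical_def)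
qed

lemma radical_eqD:
  assumes "x \<in> radical A \<tau> b" "b \<noteq> 0"
  shows "polar A x = (- \<tau> / b) *s frob_vec x"
proof -
  have "b *s polar A x = (- \<tau>) *s frob_vec x"
    using assms(1) by (simp add: radical_def eq_neg_iff_add_eq_0 add.commute)
  then have "(1 / b) *s (b *s polar A x) = (1 / b) *s ((- \<tau>) *s frob_vec x)"
    by (rule arg_cong)
  then show ?thesis
    using assms(2) by (simp only: vector_smult_assoc) simp
qed

text \<open>The two terms of the radical equation scale by \<open>w ^ t\<close> and by
  \<open>w\<close>. These differ for \<open>w\<close> outside \<open>K\<close>, so both equations
  together leave a nonzero multiple of \<open>frob_vec x\<close>.\<close>

lemma radical_scale_imp_0:
  assumes w: "w \<notin> K" and \<tau>: "\<tau> \<noteq> 0" and x: "x \<in> radical A \<tau> b" "w *s x \<in> radical A \<tau> b"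
  shows "x = 0"
proof -
  have "(\<tau> *s frob_vec (w *s x) + b *s polar A (w *s x)) - w *s (\<tau> *s frob_vec x + b *s polar A x)
      = (\<tau> * (w ^ t - w)) *s frob_vec x"
    by (simp add: vec_eq_iff frob_vec_scale polar_scale algebra_simps)
  then have "(\<tau> * (w ^ t - w)) *s frob_vec x = 0"
    using x by (simp add: radical_def)
  then show ?thesis
    using w \<tau> by (simp add: vec.scale_eq_0_iff K_iff)
qed

text \<open>The counting form of the statement that \<open>K\<close>-independent radical vectors are
  \<open>F\<close>-independent: the radical and its multiple by \<open>w\<close> meet only in
  0.\<close>

lemma inj_on_radical_sum:
  assumes w: "w \<notin> K" and \<tau>: "\<tau> \<noteq> 0"
  shows "inj_on (\<lambda>(x, y). x + w *s y) (radical A \<tau> b \<times> radical A \<tau> b)"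
proof (rule inj_onI, clarsimp)
  fix x y x' y' assume *: "x \<in> radical A \<tau> b" "y \<in> radical A \<tau> b" "x' \<in> radical A \<tau> b"
    "y' \<in> radical A \<tau> b" "x + w *s y = x' + w *s y'"
  have m: "- 1 \<in> K"
    by (intro K_minus K_1)
  have d: "u + (- 1) *s v \<in> radical A \<tau> b" if "u \<in> radical A \<tau> b" "v \<in> radical A \<tau> b" for u v
    using that m by (intro radical_add radical_scale)
  have "w *s (y + (- 1) *s y') = x' + (- 1) *s x"
    using *(5) by (simp add: vec_eq_iff algebra_simps)
  then have "y + (- 1) *s y' = 0"
    using radical_scale_imp_0[OF w \<tau>, of "y + (- 1) *s y'" A b] d * by metis
  then have "y = y'"
    by simp
  with * show "x = x' \<and> y = y'"
    by simp
qed

text \<open>For \<open>w\<close> outside \<open>K\<close> this is the \<open>F\<close>-span of the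
  radical, since \<open>1\<close> and \<open>w\<close> are then a \<open>K\<close>-basis of the
  field.\<close>

definition radical_span :: "'a \<Rightarrow> 'a ^ 'n::finite ^ 'n \<Rightarrow> 'a \<Rightarrow> 'a \<Rightarrow> ('a ^ 'n) set" where
  "radical_span w A \<tau> b = (\<lambda>(x, y). x + w *s y) ` (radical A \<tau> b \<times> radical A \<tau> b)"

lemma card_radical_span:
  assumes "w \<notin> K" "\<tau> \<noteq> 0"
  shows "card (radical_span w A \<tau> b) = (card (radical A \<tau> b))\<^sup>2"
  unfolding radical_span_def card_image[OF inj_on_radical_sum[OF assms]]
  by (simp add: card_cartesian_product power2_eq_square)

lemma subspace_radical_span:
  assumes w: "w \<notin> K"
  shows "vec.subspace (radical_span w A \<tau> b)"
proof (rule vec.subspaceI)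
  show "0 \<in> radical_span w A \<tau> b"
    unfolding radical_span_def using zero_in_radical[of A \<tau> b] by force
next
  fix u v assume "u \<in> radical_span w A \<tau> b" "v \<in> radical_span w A \<tau> b"
  then obtain x y x' y' where *: "u = x + w *s y" "v = x' + w *s y'" "x \<in> radical A \<tau> b"
      "y \<in> radical A \<tau> b" "x' \<in> radical A \<tau> b" "y' \<in> radical A \<tau> b"
    by (auto simp: radical_span_def)
  then have "u + v = (\<lambda>(x, y). x + w *s y) (x + x', y + y')"
    by (simp add: vec_eq_iff algebra_simps)
  then show "u + v \<in> radical_span w A \<tau> b"
    unfolding radical_span_def using * radical_add by blast
next
  fix c u assume "u \<in> radical_span w A \<tau> b"
  then obtain x y where *: "u = x + w *s y" "x \<in> radical A \<tau> b" "y \<in> radical A \<tau> b"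
    by (auto simp: radical_span_def)
  obtain c1 c2 where c: "c = c1 + w * c2" "c1 \<in> K" "c2 \<in> K"
    using K_decomp[OF w] by blast
  obtain d1 d2 where d: "c * w = d1 + w * d2" "d1 \<in> K" "d2 \<in> K"
    using K_decomp[OF w] by blast
  have "c *s u = c *s x + (c * w) *s y"
    by (simp add: * vec.scale_right_distrib)
  also have "\<dots> = (\<lambda>(x, y). x + w *s y) (c1 *s x + d1 *s y, c2 *s x + d2 *s y)"
    unfolding d(1) unfolding c(1) by (simp add: vec_eq_iff algebra_simps)
  finally show "c *s u \<in> radical_span w A \<tau> b"
    unfolding radical_span_def using * c d radical_add radical_scale by blast
qed

text \<open>The span is an \<open>F\<close>-subspace whose size is the square of that of the
  radical. If it is proper it loses a factor \<open>t\<^sup>2\<close>, so the radical loses a factor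
  \<open>t\<close>.\<close>

lemma card_radical_gap:
  fixes A :: "'a ^ 'n::finite ^ 'n"
  assumes \<tau>: "\<tau> \<noteq> 0" and less: "card (radical A \<tau> b) < t ^ CARD('n)"
  shows "card (radical A \<tau> b) * t \<le> t ^ CARD('n)"
proof -
  obtain w where w: "w \<notin> K"
    using not_all_in_K by blast
  have "(card (radical A \<tau> b))\<^sup>2 < (t ^ CARD('n))\<^sup>2"
    using less by (intro power_strict_mono) auto
  then have "card (radical_span w A \<tau> b) < CARD('a) ^ CARD('n)"
    by (simp add: card_radical_span[OF w \<tau>] card_F power_mult[symmetric] mult.commute)
  then have "card (radical_span w A \<tau> b) * CARD('a) \<le> CARD('a) ^ CARD('n)"
    using card_proper_subspace[OF subspace_radical_span[OF w]] by blast
  then have "(card (radical A \<tau> b) * t)\<^sup>2 \<le> (t ^ CARD('n))\<^sup>2"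
    by (simp add: card_radical_span[OF w \<tau>] card_F power_mult_distrib power_mult[symmetric] mult.commute)
  then show ?thesis
    by (simp add: power2_nat_le_eq_le)
qed

text \<open>On the radical \<open>frob_vec\<close> is a scalar multiple of \<open>polar A\<close>,
  so it embeds the span of the radical into the range of \<open>polar A\<close>. The size of that
  range comes from the kernel.\<close>

lemma card_radical_le:
  fixes A :: "'a ^ 'n::finite ^ 'n"
  assumes \<tau>: "\<tau> \<noteq> 0" and b: "b \<noteq> 0"
  shows "(card (radical A \<tau> b))\<^sup>2 * card {x. polar A x = 0} \<le> t ^ (2 * CARD('n))"
proof -
  obtain w where w: "w \<notin> K"
    using not_all_in_K by blast
  have "frob_vec ` radical_span w A \<tau> b \<subseteq> range (polar A)"
  proof clarify
    fix u assume "u \<in> radical_span w A \<tau> b"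
    then obtain x y where *: "u = x + w *s y" "x \<in> radical A \<tau> b" "y \<in> radical A \<tau> b"
      by (auto simp: radical_span_def)
    \<comment> \<open>\<open>frob_vec\<close> is semilinear, so the linear map
      \<open>polar A\<close> must be fed \<open>w ^ t\<close> in place of \<open>w\<close>.\<close>
    have "frob_vec u = polar A ((- b / \<tau>) *s (x + w ^ t *s y))"
      using \<tau> b unfolding polar_scale polar_add
      by (simp add: *(1) frob_vec_add frob_vec_scale radical_eqD[OF *(2) b] radical_eqD[OF *(3) b]
          vec_eq_iff field_simps)
    then show "frob_vec u \<in> range (polar A)"
      by simp
  qed
  moreover have "inj_on frob_vec (radical_span w A \<tau> b)"
    by (rule inj_on_inverseI[of _ frob_vec]) simp
  ultimately have "card (radical_span w A \<tau> b) \<le> card (range (polar A))"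
    by (intro card_inj_on_le[of frob_vec]) auto
  then have "card (radical_span w A \<tau> b) * card {x. polar A x = 0} \<le> CARD('a ^ 'n)"
    by (subst card_kernel_image[of "polar A"]) (auto simp: polar_add)
  then show ?thesis
    by (simp add: card_radical_span[OF w \<tau>] card_F power_mult[symmetric])
qed

text \<open>
  If the radical at \<open>(\<tau>', b')\<close> has full size, its \<open>K\<close>-basis is a basis of the whole space, and a
  nonzero vector of another radical is then a scalar multiple of one of its vectors; this makes
  the ratio of \<open>b / \<tau>\<close> to \<open>b' / \<tau>'\<close> a root of unity of order dividing \<open>t + 1\<close>.
\<close>

lemma card_nonzero_radicals_le:
  fixes A :: "'a ^ 'n::finite ^ 'n"
  assumes full: "card (radical A \<tau>' b') = t ^ CARD('n)" and nz: "\<tau>' \<noteq> 0" "b' \<noteq> 0" "\<tau> \<noteq> 0"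
  shows "card {b. b \<noteq> 0 \<and> radical A \<tau> b \<noteq> {0}} \<le> t + 1"
proof -
  obtain w where w: "w \<notin> K"
    using not_all_in_K by blast
  have "card (radical_span w A \<tau>' b') = CARD('a ^ 'n)"
    by (simp add: card_radical_span[OF w nz(1)] full card_F power_mult[symmetric] mult.commute)
  then have span: "radical_span w A \<tau>' b' = UNIV"
    by (intro card_subset_eq) auto
  \<comment> \<open>Normalises so that \<open>b / k\<close> is the ratio of
    \<open>b / \<tau>\<close> to \<open>b' / \<tau>'\<close>.\<close>
  define k where "k = \<tau> * b' / \<tau>'"
  have root: "(b / k) ^ (t + 1) = 1" if b: "b \<noteq> 0" "radical A \<tau> b \<noteq> {0}" for b
  proof -
    define r where "r = b / k"
    have r0: "r \<noteq> 0"
      using b nz by (simp add: r_def k_def)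
    have r_eq: "\<tau> / b = \<tau>' / b' / r"
      using b nz by (simp add: r_def k_def)
    obtain z where z: "z \<in> radical A \<tau> b" "z \<noteq> 0"
      using b zero_in_radical[of A \<tau> b] by blast
    have "z \<in> radical_span w A \<tau>' b'"
      by (simp add: span)
    then obtain x y where xy: "z = x + w *s y" "x \<in> radical A \<tau>' b'" "y \<in> radical A \<tau>' b'"
      by (auto simp: radical_span_def)
    note pol = radical_eqD[OF xy(2) nz(2)] radical_eqD[OF xy(3) nz(2)]
    show ?thesis
    proof (cases "r = 1")
      case False
      have "(- \<tau> / b) *s frob_vec z = (- \<tau>' / b') *s (frob_vec x + w *s frob_vec y)"
        using radical_eqD[OF z(1) b(1)]
        by (simp add: xy(1) polar_add polar_scale pol vec_eq_iff algebra_simps)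
      then have "(- r * b' / \<tau>') *s ((- \<tau> / b) *s frob_vec z) =
          (- r * b' / \<tau>') *s ((- \<tau>' / b') *s (frob_vec x + w *s frob_vec y))"
        by (rule arg_cong)
      then have fz: "frob_vec z = r *s (frob_vec x + w *s frob_vec y)"
        using r0 nz r_eq by (simp add: vector_smult_assoc)
      \<comment> \<open>Both radical equations evaluate \<open>polar A z\<close>. For
        \<open>r \<noteq> 1\<close> the comparison makes \<open>x\<close>, and hence
        \<open>z\<close>, an \<open>F\<close>-multiple of \<open>y\<close>.\<close>
      have "(1 - r) *s frob_vec x = (r * w - w ^ t) *s frob_vec y"
        using fz unfolding xy(1) by (simp add: frob_vec_add frob_vec_scale vec_eq_iff algebra_simps)
      then have "(1 / (1 - r)) *s ((1 - r) *s frob_vec x) = (1 / (1 - r)) *s ((r * w - w ^ t) *s frob_vec y)"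
        by (rule arg_cong)
      then have fx: "frob_vec x = ((r * w - w ^ t) / (1 - r)) *s frob_vec y"
        using False by (simp add: vector_smult_assoc)
      define c where "c = ((r * w - w ^ t) / (1 - r)) ^ t"
      have x_eq: "x = c *s y"
        using arg_cong[OF fx, of frob_vec] by (simp only: frob_vec_scale frob_vec_frob_vec c_def)
      define e where "e = c + w"
      have z_eq: "z = e *s y"
        by (simp add: xy(1) x_eq e_def vec.scale_left_distrib)
      have ye: "y \<noteq> 0" "e \<noteq> 0"
        using z(2) z_eq by auto
      have "polar A z = (- \<tau> / b) *s (e ^ t *s frob_vec y)"
        using radical_eqD[OF z(1) b(1)] by (simp only: z_eq frob_vec_scale)
      moreover have "polar A z = e *s ((- \<tau>' / b') *s frob_vec y)"
        by (simp only: z_eq polar_scale pol(2))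
      ultimately have "(- \<tau> / b * e ^ t - e * (- \<tau>' / b')) *s frob_vec y = 0"
        by (simp only: vector_smult_assoc vec.scale_left_diff_distrib) simp
      then have "- \<tau> / b * e ^ t = e * (- \<tau>' / b')"
        using ye(1) by (simp only: vec.scale_eq_0_iff frob_vec_eq_0_iff) simp
      then have "\<tau>' / b' / r * e ^ t = e * (\<tau>' / b')"
        by (simp add: r_eq)
      then have et: "e ^ t = r * e"
        using nz r0 by (simp add: field_simps)
      \<comment> \<open>Applying the involution to \<open>e ^ t = r * e\<close> returns
        \<open>e\<close> and produces the exponent \<open>t + 1\<close>.\<close>
      have "e = (r * e) ^ t"
        unfolding et[symmetric] by simp
      also have "\<dots> = r ^ (t + 1) * e"
        by (simp add: power_mult_distrib et)
      finally show ?thesis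
        using ye(2) unfolding mult_cancel_right1 r_def by blast
    qed (simp add: r_def[symmetric])
  qed
  then have "(\<lambda>b. b / k) ` {b. b \<noteq> 0 \<and> radical A \<tau> b \<noteq> {0}} \<subseteq> {x. x ^ (t + 1) = 1}"
    by blast
  moreover have "k \<noteq> 0"
    using nz by (simp add: k_def)
  ultimately have "card {b. b \<noteq> 0 \<and> radical A \<tau> b \<noteq> {0}} \<le> card {x :: 'a. x ^ (t + 1) = 1}"
    by (intro card_inj_on_le) (auto simp: inj_on_def)
  also have "\<dots> \<le> t + 1"
    by (rule card_power_eq_le) simp
  finally show ?thesis .
qed

end

section \<open>Character sums\<close>

context invariant_character
begin

definition form_sum :: "'a ^ 'n::finite ^ 'n \<Rightarrow> 'a \<Rightarrow> 'a \<Rightarrow> complex" where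
  "form_sum A \<theta> b = (\<Sum>x\<in>UNIV. \<psi> (\<theta> * herm x x + b * quad_form A x))"

lemma char_sum_dot:
  fixes v :: "'a ^ 'n::finite"
  shows "(\<Sum>y\<in>UNIV. \<psi> (dot y v)) = (if v = 0 then of_nat CARD('a ^ 'n) else 0)"
proof (cases "v = 0")
  case False
  then obtain i where i: "v $ i \<noteq> 0"
    by (auto simp: vec_eq_iff)
  obtain c where c: "\<psi> c \<noteq> 1"
    using char_nontrivial by blast
  have "(\<Sum>y\<in>UNIV. \<psi> (dot y v)) = (\<Sum>y\<in>UNIV. \<psi> (dot (y + axis i (c / v $ i)) v))"
    by (rule sum.reindex_bij_witness[of _ "\<lambda>y. y + axis i (c / v $ i)" "\<lambda>y. y - axis i (c / v $ i)"]) auto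
  also have "\<dots> = \<psi> c * (\<Sum>y\<in>UNIV. \<psi> (dot y v))"
    using i by (simp add: dot_add_left dot_axis char_add sum_distrib_left mult.commute)
  finally show ?thesis
    using False c by auto
qed simp

text \<open>The cross term \<open>\<theta> * herm x y\<close> is semilinear in \<open>y\<close>, but
  \<open>\<psi>\<close> does not distinguish it from its \<open>t\<close>-th power
  \<open>\<theta> ^ t * herm y x\<close>. The total cross term thus becomes linear in
  \<open>y\<close>, and the vector paired with \<open>y\<close> vanishes exactly on the
  radical.\<close>

lemma char_form_add:
  "\<psi> (\<theta> * herm (x + y) (x + y) + b * quad_form A (x + y)) =
    \<psi> (\<theta> * herm x x + b * quad_form A x) * \<psi> (\<theta> * herm y y + b * quad_form A y) *
    \<psi> (dot y ((\<theta> + \<theta> ^ t) *s frob_vec x + b *s polar A x))"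
proof -
  have "\<psi> (\<theta> * herm x y) = \<psi> (\<theta> ^ t * herm y x)"
    by (subst char_frob[symmetric]) (simp add: power_mult_distrib herm_conj)
  then have "\<psi> (\<theta> * herm x y + \<theta> * herm y x) = \<psi> ((\<theta> + \<theta> ^ t) * herm y x)"
    by (simp add: char_add distrib_right)
  moreover have "\<theta> * herm (x + y) (x + y) + b * quad_form A (x + y) =
      (\<theta> * herm x x + b * quad_form A x) + (\<theta> * herm y y + b * quad_form A y) +
      (\<theta> * herm x y + \<theta> * herm y x) + b * dot y (polar A x)"
    by (simp add: herm_add_left herm_add_right quad_form_add algebra_simps)
  ultimately show ?thesis
    by (simp only: char_add dot_add_right dot_scale_right herm_eq_dot[of y x]) (simp only: mult.assoc)
qed

text \<open>In the sum times its conjugate, the shift of \<open>x\<close> by \<open>y\<close> leaves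
  a character linear in \<open>y\<close>. Summing over \<open>y\<close> kills every \<open>x\<close>
  outside the radical, where the remaining unit values are bounded trivially.\<close>

lemma norm_form_sum_le:
  fixes A :: "'a ^ 'n::finite ^ 'n"
  shows "(norm (form_sum A \<theta> b))\<^sup>2 \<le> t ^ (2 * CARD('n)) * card (radical A (\<theta> + \<theta> ^ t) b)"
proof -
  define G where "G x = \<psi> (\<theta> * herm x x + b * quad_form A x)" for x
  define r where "r x = (\<theta> + \<theta> ^ t) *s frob_vec x + b *s polar A x" for x
  have nG: "norm (G x) = 1" for x
    by (simp add: G_def)
  have "form_sum A \<theta> b * cnj (form_sum A \<theta> b) = (\<Sum>y\<in>UNIV. \<Sum>x\<in>UNIV. G x * cnj (G y))"
    unfolding form_sum_def G_def[symmetric] cnj_sum sum_product by (rule sum.swap)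
  also have "\<dots> = (\<Sum>y\<in>UNIV. \<Sum>x\<in>UNIV. G x * \<psi> (dot y (r x)))"
  proof (rule sum.cong[OF refl])
    fix y
    have "(\<Sum>x\<in>UNIV. G x * cnj (G y)) = (\<Sum>x\<in>UNIV. G (x + y) * cnj (G y))"
      by (rule sum.reindex_bij_witness[of _ "\<lambda>x. x + y" "\<lambda>x. x - y"]) auto
    also have "\<dots> = (\<Sum>x\<in>UNIV. G x * \<psi> (dot y (r x)) * (G y * cnj (G y)))"
      unfolding G_def r_def char_form_add by (simp only: mult_ac)
    also have "G y * cnj (G y) = 1"
      by (simp add: complex_norm_square[symmetric] nG)
    finally show "(\<Sum>x\<in>UNIV. G x * cnj (G y)) = (\<Sum>x\<in>UNIV. G x * \<psi> (dot y (r x)))"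
      by simp
  qed
  also have "\<dots> = (\<Sum>x\<in>UNIV. G x * (\<Sum>y\<in>UNIV. \<psi> (dot y (r x))))"
    by (subst sum.swap) (simp add: sum_distrib_left)
  also have "\<dots> = (\<Sum>x\<in>radical A (\<theta> + \<theta> ^ t) b. G x * of_nat CARD('a ^ 'n))"
    unfolding char_sum_dot
    by (rule sum.mono_neutral_cong_right) (auto simp: radical_def r_def)
  finally have "complex_of_real ((norm (form_sum A \<theta> b))\<^sup>2) =
      (\<Sum>x\<in>radical A (\<theta> + \<theta> ^ t) b. G x * of_nat CARD('a ^ 'n))"
    unfolding complex_norm_square .
  then have "(norm (form_sum A \<theta> b))\<^sup>2 =
      norm (\<Sum>x\<in>radical A (\<theta> + \<theta> ^ t) b. G x * of_nat CARD('a ^ 'n))"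
    by (metis norm_of_real abs_of_nonneg zero_le_power2)
  also have "\<dots> \<le> (\<Sum>x\<in>radical A (\<theta> + \<theta> ^ t) b. norm (G x * of_nat CARD('a ^ 'n)))"
    by (rule norm_sum)
  also have "\<dots> = t ^ (2 * CARD('n)) * card (radical A (\<theta> + \<theta> ^ t) b)"
    by (simp add: norm_mult nG card_F power_mult[symmetric] norm_power)
  finally show ?thesis .
qed

lemma char_sum_indicator: "(\<Sum>\<theta>\<in>UNIV. \<psi> (\<theta> * c)) = (if c = 0 then of_nat (t\<^sup>2) else 0)"
  using char_sum[of c] by (simp add: mult.commute)

lemma sum_indicator_card:
  "(\<Sum>x\<in>UNIV. if P x then (c::complex) else 0) = c * of_nat (card {x::'b::finite. P x})"
  by (simp add: sum.If_cases mult.commute)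

lemma sum_form_sum:
  fixes A :: "'a ^ 'n::finite ^ 'n"
  shows "(\<Sum>\<theta>\<in>UNIV. \<Sum>b\<in>UNIV. form_sum A \<theta> b) =
    of_nat (t ^ 4 * card {x. herm x x = 0 \<and> quad_form A x = 0})"
proof -
  have "(\<Sum>\<theta>\<in>UNIV. \<Sum>b\<in>UNIV. form_sum A \<theta> b) =
      (\<Sum>\<theta>\<in>UNIV. \<Sum>x\<in>UNIV. \<Sum>b\<in>UNIV. \<psi> (\<theta> * herm x x) * \<psi> (b * quad_form A x))"
    unfolding form_sum_def char_add by (intro sum.cong refl sum.swap)
  also have "\<dots> = (\<Sum>x\<in>UNIV. \<Sum>\<theta>\<in>UNIV. \<Sum>b\<in>UNIV. \<psi> (\<theta> * herm x x) * \<psi> (b * quad_form A x))"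
    by (rule sum.swap)
  also have "\<dots> = (\<Sum>x\<in>UNIV. (\<Sum>\<theta>\<in>UNIV. \<psi> (\<theta> * herm x x)) * (\<Sum>b\<in>UNIV. \<psi> (b * quad_form A x)))"
    by (simp add: sum_product)
  also have "\<dots> = (\<Sum>x\<in>UNIV. if herm x x = 0 \<and> quad_form A x = 0 then of_nat (t ^ 4) else 0)"
    unfolding char_sum_indicator by (intro sum.cong) (auto simp flip: power_add)
  finally show ?thesis
    unfolding sum_indicator_card by simp
qed

lemma sum_form_sum_quadric:
  fixes A :: "'a ^ 'n::finite ^ 'n"
  shows "(\<Sum>b\<in>UNIV. form_sum A 0 b) = of_nat (t\<^sup>2 * card {x. quad_form A x = 0})"
proof -
  have "(\<Sum>b\<in>UNIV. form_sum A 0 b) = (\<Sum>x\<in>UNIV. \<Sum>b\<in>UNIV. \<psi> (b * quad_form A x))"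
    unfolding form_sum_def by simp (rule sum.swap)
  then show ?thesis
    unfolding char_sum_indicator sum_indicator_card by simp
qed

lemma sum_form_sum_hermitian:
  fixes A :: "'a ^ 'n::finite ^ 'n"
  shows "(\<Sum>\<theta>\<in>UNIV. form_sum A \<theta> 0) = of_nat (t\<^sup>2 * isotropic_card (UNIV :: ('a ^ 'n) set))"
proof -
  have "(\<Sum>\<theta>\<in>UNIV. form_sum A \<theta> 0) = (\<Sum>x\<in>(UNIV :: ('a ^ 'n) set). \<Sum>\<theta>\<in>UNIV. \<psi> (\<theta> * herm x x))"
    unfolding form_sum_def by simp (rule sum.swap)
  then show ?thesis
    unfolding char_sum_indicator sum_indicator_card by (simp add: isotropic_card_def)
qed

text \<open>As \<open>herm x x\<close> lies in \<open>K\<close>, the trace of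
  \<open>\<theta> * herm x x\<close> is that of \<open>\<theta>\<close> times
  \<open>herm x x\<close>.\<close>

lemma form_sum_trace_0:
  assumes "\<theta> + \<theta> ^ t = 0"
  shows "form_sum A \<theta> b = form_sum A 0 b"
proof -
  have "\<psi> (\<theta> * herm x x) = 1" for x :: "'a ^ 'b"
  proof (rule char_trace_0)
    have "\<theta> * herm x x + (\<theta> * herm x x) ^ t = (\<theta> + \<theta> ^ t) * herm x x"
      using herm_self_in_K[of x] by (simp add: K_iff power_mult_distrib distrib_right)
    then show "\<theta> * herm x x + (\<theta> * herm x x) ^ t = 0"
      using assms by simp
  qed
  then show ?thesis
    by (simp add: form_sum_def char_add)
qed

lemma form_sum_0_0:
  fixes A :: "'a ^ 'n::finite ^ 'n"
  shows "form_sum A 0 0 = of_nat (t ^ (2 * CARD('n)))"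
  by (simp add: form_sum_def card_F power_mult)

text \<open>The \<open>t\<close> elements of trace 0 each contribute \<open>t\<^sup>2\<close> times
  the number of zeros of the form. The terms with \<open>b = 0\<close> and nonzero trace give the
  isotropic count minus \<open>t\<close> trivial sums; all others enter through absolute
  values.\<close>

lemma card_hermitian_quadric_le:
  fixes A :: "'a ^ 'n::finite ^ 'n"
  shows "real t ^ 4 * card {x. herm x x = 0 \<and> quad_form A x = 0} \<le>
    real t ^ 3 * card {x. quad_form A x = 0} +
    (real t ^ 2 * isotropic_card (UNIV :: ('a ^ 'n) set) - real t ^ (2 * CARD('n) + 1)) +
    (\<Sum>\<theta> | \<theta> + \<theta> ^ t \<noteq> 0. \<Sum>b | b \<noteq> 0. norm (form_sum A \<theta> b))"
proof -
  let ?N = "{\<theta>::'a. \<theta> + \<theta> ^ t = 0}" and ?T = "{\<theta>::'a. \<theta> + \<theta> ^ t \<noteq> 0}"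
  define E where "E = (\<Sum>\<theta>\<in>?T. \<Sum>b | b \<noteq> 0. form_sum A \<theta> b)"
  have cT0: "card ?N = t"
    by (rule card_trace_fibre[OF K_0])
  have un: "sum f UNIV = sum f ?N + sum f ?T" for f :: "'a \<Rightarrow> complex"
    by (subst sum.union_disjoint[symmetric]) (auto intro!: sum.cong)
  have unb: "sum f UNIV = f 0 + (\<Sum>b | b \<noteq> 0. f b)" for f :: "'a \<Rightarrow> complex"
    by (subst sum.remove[of _ 0]) (auto intro!: sum.cong)
  have 1: "(\<Sum>\<theta>\<in>?N. \<Sum>b\<in>UNIV. form_sum A \<theta> b) = of_nat (t ^ 3 * card {x. quad_form A x = 0})"
  proof -
    have "(\<Sum>\<theta>\<in>?N. \<Sum>b\<in>UNIV. form_sum A \<theta> b) = (\<Sum>\<theta>\<in>?N. \<Sum>b\<in>UNIV. form_sum A 0 b)"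
      by (intro sum.cong refl form_sum_trace_0) simp
    then show ?thesis
      by (simp add: sum_form_sum_quadric cT0 eval_nat_numeral)
  qed
  have "(\<Sum>\<theta>\<in>?N. form_sum A \<theta> 0) = of_nat (t ^ (2 * CARD('n) + 1))"
  proof -
    have "(\<Sum>\<theta>\<in>?N. form_sum A \<theta> 0) = (\<Sum>\<theta>\<in>?N. form_sum A 0 0)"
      by (intro sum.cong refl form_sum_trace_0) simp
    then show ?thesis
      by (simp add: form_sum_0_0 cT0)
  qed
  then have 2: "(\<Sum>\<theta>\<in>?T. form_sum A \<theta> 0) =
      of_nat (t\<^sup>2 * isotropic_card (UNIV :: ('a ^ 'n) set)) - of_nat (t ^ (2 * CARD('n) + 1))"
    using un[of "\<lambda>\<theta>. form_sum A \<theta> 0"] sum_form_sum_hermitian[of A] by simp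
  have "(\<Sum>\<theta>\<in>?T. \<Sum>b\<in>UNIV. form_sum A \<theta> b) = (\<Sum>\<theta>\<in>?T. form_sum A \<theta> 0) + E"
    unfolding E_def by (subst unb) (rule sum.distrib)
  then have "of_nat (t ^ 4 * card {x. herm x x = 0 \<and> quad_form A x = 0}) =
      of_nat (t ^ 3 * card {x. quad_form A x = 0}) +
      (of_nat (t\<^sup>2 * isotropic_card (UNIV :: ('a ^ 'n) set)) - of_nat (t ^ (2 * CARD('n) + 1))) + E"
    unfolding sum_form_sum[symmetric] un[of "\<lambda>\<theta>. \<Sum>b\<in>UNIV. form_sum A \<theta> b"] 1 2 by simp
  from arg_cong[OF this, of Re]
  have "real (t ^ 4 * card {x. herm x x = 0 \<and> quad_form A x = 0}) =
      real (t ^ 3 * card {x. quad_form A x = 0}) +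
      (real (t\<^sup>2 * isotropic_card (UNIV :: ('a ^ 'n) set)) - real (t ^ (2 * CARD('n) + 1))) + Re E"
    by (simp only: plus_complex.sel minus_complex.sel complex_Re_of_nat)
  moreover have "Re E \<le> (\<Sum>\<theta>\<in>?T. \<Sum>b | b \<noteq> 0. norm (form_sum A \<theta> b))"
    unfolding E_def
    by (rule order_trans[OF complex_Re_le_cmod])
      (intro order_trans[OF norm_sum] sum_mono order_refl)
  ultimately show ?thesis
    by simp
qed

lemma card_nonzero: "real (card {b::'a. b \<noteq> 0}) = real t ^ 2 - 1"
proof -
  have "{b::'a. b \<noteq> 0} = UNIV - {0}"
    by auto
  then show ?thesis
    using t_ge_2 by (simp add: card_F of_nat_diff)
qed

text \<open>At trace 0 the radical is the polar kernel, of \<open>F\<close>-dimension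
  \<open>s\<close>, so each of the \<open>t\<^sup>2 - 1\<close> sums with
  \<open>b \<noteq> 0\<close> is at most \<open>t ^ (n + s)\<close> for \<open>n\<close>
  variables.\<close>

lemma card_quadric_le:
  fixes A :: "'a ^ 'n::finite ^ 'n"
  assumes "card {x. polar A x = 0} = t ^ (2 * s)"
  shows "real t ^ 2 * card {x. quad_form A x = 0} \<le>
    real t ^ (2 * CARD('n)) + (real t ^ 2 - 1) * real t ^ (CARD('n) + s)"
proof -
  have "norm (form_sum A 0 b) \<le> real t ^ (CARD('n) + s)" if "b \<noteq> 0" for b
  proof (rule power2_le_imp_le)
    have "(real t ^ (CARD('n) + s))\<^sup>2 = real t ^ (2 * CARD('n)) * real t ^ (2 * s)"
      by (simp add: mult.commute add.commute flip: power_mult power_add)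
    then show "(norm (form_sum A 0 b))\<^sup>2 \<le> (real t ^ (CARD('n) + s))\<^sup>2"
      using norm_form_sum_le[of A 0 b] that by (simp add: radical_0 assms)
  qed simp
  then have "(\<Sum>b | b \<noteq> 0. norm (form_sum A 0 b)) \<le> (\<Sum>b::'a | b \<noteq> 0. real t ^ (CARD('n) + s))"
    by (intro sum_mono) auto
  also have "\<dots> = real (card {b::'a. b \<noteq> 0}) * real t ^ (CARD('n) + s)"
    by simp
  finally have le: "(\<Sum>b | b \<noteq> 0. norm (form_sum A 0 b)) \<le> (real t ^ 2 - 1) * real t ^ (CARD('n) + s)"
    by (simp only: card_nonzero)
  have "of_nat (t\<^sup>2 * card {x. quad_form A x = 0}) = form_sum A 0 0 + (\<Sum>b | b \<noteq> 0. form_sum A 0 b)"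
    unfolding sum_form_sum_quadric[symmetric] by (subst sum.remove[of _ 0]) (auto intro!: sum.cong)
  then have "real (t\<^sup>2 * card {x. quad_form A x = 0}) =
      norm (form_sum A 0 0 + (\<Sum>b | b \<noteq> 0. form_sum A 0 b))"
    by (metis norm_of_nat)
  also have "\<dots> \<le> norm (form_sum A 0 0) + (\<Sum>b | b \<noteq> 0. norm (form_sum A 0 b))"
    by (rule order_trans[OF norm_triangle_ineq add_left_mono[OF norm_sum]])
  also have "norm (form_sum A 0 0) = real t ^ (2 * CARD('n))"
    unfolding form_sum_0_0 norm_of_nat by simp
  finally show ?thesis
    using le by simp
qed

end

section \<open>Quadrics that are not pairs of hyperplanes\<close>

text \<open>
  Stated for vectors of the cone, of which there are \<open>1 + (t\<^sup>2 - 1) N\<close> over \<open>N\<close> points;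
  for \<open>t = 2\<close> it says \<open>N \<le> 69\<close>.
\<close>

definition small_cone :: "nat \<Rightarrow> nat \<Rightarrow> bool" where
  "small_cone t n \<longleftrightarrow> (if t = 2 then n \<le> 210 else
     real n \<le> 2 * real t ^ 7 - real t ^ 6 + real t ^ 5 + real t ^ 4 - 4 * real t ^ 3 + real t ^ 2 + real t)"

context invariant_character
begin

lemma card_trace_nonzero: "real (card {\<theta>::'a. \<theta> + \<theta> ^ t \<noteq> 0}) = real t ^ 2 - real t"
proof -
  have "{\<theta>::'a. \<theta> + \<theta> ^ t \<noteq> 0} = UNIV - {\<theta>. \<theta> + \<theta> ^ t = 0}"
    by auto
  then have "card {\<theta>::'a. \<theta> + \<theta> ^ t \<noteq> 0} = t\<^sup>2 - t"
    using card_trace_fibre[OF K_0] by (simp add: card_Diff_subset card_F)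
  then show ?thesis
    using t_ge_2 by (simp add: of_nat_diff power2_eq_square)
qed

lemma norm_form_sum_le_root:
  fixes A :: "'a ^ 5 ^ 5"
  assumes "real (card (radical A (\<theta> + \<theta> ^ t) b)) \<le> r\<^sup>2" "0 \<le> r"
  shows "norm (form_sum A \<theta> b) \<le> real t ^ 5 * r"
proof (rule power2_le_imp_le)
  have "real t ^ 10 * real (card (radical A (\<theta> + \<theta> ^ t) b)) \<le> real t ^ 10 * r\<^sup>2"
    using assms(1) by (intro mult_left_mono) auto
  then show "(norm (form_sum A \<theta> b))\<^sup>2 \<le> (real t ^ 5 * r)\<^sup>2"
    using norm_form_sum_le[of A \<theta> b] by (simp add: power_mult_distrib flip: power_mult)
qed (use assms in simp)

lemma sum_norm_form_sum_le:
  fixes A :: "'a ^ 5 ^ 5"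
  assumes "\<And>\<theta> b. \<theta> + \<theta> ^ t \<noteq> 0 \<Longrightarrow> b \<noteq> 0 \<Longrightarrow> real (card (radical A (\<theta> + \<theta> ^ t) b)) \<le> r\<^sup>2"
    and "0 \<le> r"
  shows "(\<Sum>\<theta> | \<theta> + \<theta> ^ t \<noteq> 0. \<Sum>b | b \<noteq> 0. norm (form_sum A \<theta> b)) \<le>
    (real t ^ 2 - real t) * real t ^ 5 * ((real t ^ 2 - 1) * r)"
proof -
  have "(\<Sum>\<theta> | \<theta> + \<theta> ^ t \<noteq> 0. \<Sum>b | b \<noteq> 0. norm (form_sum A \<theta> b)) \<le>
      (\<Sum>\<theta> :: 'a | \<theta> + \<theta> ^ t \<noteq> 0. \<Sum>b :: 'a | b \<noteq> 0. real t ^ 5 * r)"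
    using assms by (intro sum_mono norm_form_sum_le_root) auto
  also have "\<dots> = real (card {\<theta>::'a. \<theta> + \<theta> ^ t \<noteq> 0}) * (real (card {b::'a. b \<noteq> 0}) * (real t ^ 5 * r))"
    by simp
  finally show ?thesis
    unfolding card_trace_nonzero card_nonzero by (simp only: mult_ac)
qed

text \<open>For each \<open>\<theta>\<close> at most \<open>t + 1\<close> of the
  \<open>t\<^sup>2 - 1\<close> nonzero \<open>b\<close> have a nontrivial radical. The other
  \<open>t\<^sup>2 - t - 2\<close> cost only \<open>t ^ 5\<close> each.\<close>

lemma sum_norm_form_sum_le_full_radical:
  fixes A :: "'a ^ 5 ^ 5"
  assumes full: "card (radical A \<tau> b) = t ^ 5" "\<tau> \<noteq> 0" "b \<noteq> 0"
    and le: "\<And>\<theta> b. \<theta> + \<theta> ^ t \<noteq> 0 \<Longrightarrow> b \<noteq> 0 \<Longrightarrow> real (card (radical A (\<theta> + \<theta> ^ t) b)) \<le> r\<^sup>2"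
    and r: "1 \<le> r"
  shows "(\<Sum>\<theta> | \<theta> + \<theta> ^ t \<noteq> 0. \<Sum>b | b \<noteq> 0. norm (form_sum A \<theta> b)) \<le>
    (real t ^ 2 - real t) * real t ^ 5 * ((real t + 1) * r + (real t ^ 2 - real t - 2))"
proof -
  have inner: "(\<Sum>b | b \<noteq> 0. norm (form_sum A \<theta> b)) \<le>
      real t ^ 5 * ((real t + 1) * r + (real t ^ 2 - real t - 2))" if \<theta>: "\<theta> + \<theta> ^ t \<noteq> 0" for \<theta>
  proof -
    define M where "M = {b. b \<noteq> 0 \<and> radical A (\<theta> + \<theta> ^ t) b \<noteq> {0}}"
    have cM: "card M \<le> t + 1"
      unfolding M_def using card_nonzero_radicals_le[of A \<tau> b "\<theta> + \<theta> ^ t"] full \<theta> by simp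
    \<comment> \<open>Every term is charged \<open>t ^ 5\<close>, with a surcharge on
      \<open>M\<close>. As \<open>r\<close> is at least 1 the surcharge is nonnegative, so
      \<open>card M\<close> may be replaced by its bound.\<close>
    have "(\<Sum>b | b \<noteq> 0. norm (form_sum A \<theta> b)) \<le>
        (\<Sum>b | b \<noteq> 0. real t ^ 5 + (if b \<in> M then real t ^ 5 * (r - 1) else 0))"
    proof (rule sum_mono)
      fix b :: 'a assume b: "b \<in> {b. b \<noteq> 0}"
      show "norm (form_sum A \<theta> b) \<le> real t ^ 5 + (if b \<in> M then real t ^ 5 * (r - 1) else 0)"
      proof (cases "b \<in> M")
        case True
        then show ?thesis
          using norm_form_sum_le_root[of A \<theta> b r] le[OF \<theta>] b r by (simp add: algebra_simps)
      next
        case False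
        then have "radical A (\<theta> + \<theta> ^ t) b = {0}"
          using b by (auto simp: M_def)
        then show ?thesis
          using norm_form_sum_le_root[of A \<theta> b 1] False by simp
      qed
    qed
    also have "\<dots> = real (card {b::'a. b \<noteq> 0}) * real t ^ 5 + real (card M) * (real t ^ 5 * (r - 1))"
      by (simp add: sum.distrib sum.If_cases Int_def M_def)
    also have "\<dots> \<le> real (card {b::'a. b \<noteq> 0}) * real t ^ 5 + real (t + 1) * (real t ^ 5 * (r - 1))"
      using cM r by (intro add_left_mono mult_right_mono) auto
    also have "\<dots> = real t ^ 5 * ((real t + 1) * r + (real t ^ 2 - real t - 2))"
      unfolding card_nonzero by (simp add: algebra_simps)
    finally show ?thesis .
  qed
  have "(\<Sum>\<theta> | \<theta> + \<theta> ^ t \<noteq> 0. \<Sum>b | b \<noteq> 0. norm (form_sum A \<theta> b)) \<le>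
      (\<Sum>\<theta> :: 'a | \<theta> + \<theta> ^ t \<noteq> 0. real t ^ 5 * ((real t + 1) * r + (real t ^ 2 - real t - 2)))"
    using inner by (intro sum_mono) auto
  also have "\<dots> = real (card {\<theta>::'a. \<theta> + \<theta> ^ t \<noteq> 0}) *
      (real t ^ 5 * ((real t + 1) * r + (real t ^ 2 - real t - 2)))"
    by simp
  finally show ?thesis
    unfolding card_trace_nonzero by (simp only: mult.assoc)
qed

text \<open>Here \<open>s\<close> is the exponent in the quadric count and \<open>e\<close> bounds,
  in units of \<open>t ^ 5\<close>, the average over \<open>\<theta>\<close> of the inner sums over
  \<open>b\<close>.\<close>

lemma card_cone_le:
  fixes A :: "'a ^ 5 ^ 5"
  assumes Q: "real t ^ 2 * card {x. quad_form A x = 0} \<le> real t ^ 10 + (real t ^ 2 - 1) * real t ^ (5 + s)"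
    and E: "(\<Sum>\<theta> | \<theta> + \<theta> ^ t \<noteq> 0. \<Sum>b | b \<noteq> 0. norm (form_sum A \<theta> b)) \<le>
      (real t ^ 2 - real t) * real t ^ 5 * e"
  shows "real (card {x. herm x x = 0 \<and> quad_form A x = 0}) \<le>
    real t ^ 7 + (real t ^ 2 - 1) * real t ^ (2 + s) - real t ^ 3 + real t ^ 2 + (real t - 1) * real t ^ 2 * e"
    (is "real ?n \<le> ?X")
proof -
  have iso: "real (isotropic_card (UNIV :: ('a ^ 5) set)) = real t ^ 9 - real t ^ 5 + real t ^ 4"
    using arg_cong[OF isotropic_card_UNIV, of real_of_int] by simp
  have "real t ^ 4 * ?n \<le> real t ^ 3 * card {x. quad_form A x = 0} +
      (real t ^ 2 * (real t ^ 9 - real t ^ 5 + real t ^ 4) - real t ^ 11) + (real t ^ 2 - real t) * real t ^ 5 * e"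
    using card_hermitian_quadric_le[of A] E by (simp add: iso)
  also have "real t ^ 3 * card {x. quad_form A x = 0} = real t * (real t ^ 2 * card {x. quad_form A x = 0})"
    by (simp add: eval_nat_numeral)
  also have "\<dots> \<le> real t * (real t ^ 10 + (real t ^ 2 - 1) * real t ^ (5 + s))"
    using Q by (intro mult_left_mono) auto
  finally have "real t ^ 4 * ?n \<le> real t * (real t ^ 10 + (real t ^ 2 - 1) * real t ^ (5 + s)) +
      (real t ^ 2 * (real t ^ 9 - real t ^ 5 + real t ^ 4) - real t ^ 11) + (real t ^ 2 - real t) * real t ^ 5 * e"
    by simp
  also have "\<dots> = real t ^ 4 * ?X"
    by (simp add: algebra_simps eval_nat_numeral)
  finally show ?thesis
    using t_ge_2 by simp
qed

text \<open>The factor \<open>3 / 5\<close> is just above \<open>1 / sqrt 3\<close>, and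
  \<open>1 + 3 / 5 < 2\<close> preserves the leading coefficient of the target. For
  \<open>t = 2\<close> the value 1.42 is precise enough to stay below 210.\<close>

lemma sqrt_t_le: "t \<noteq> 2 \<Longrightarrow> sqrt (real t) \<le> 3 / 5 * real t" and sqrt_2_le: "sqrt 2 \<le> 71 / 50"
proof -
  show "sqrt (real t) \<le> 3 / 5 * real t" if "t \<noteq> 2"
  proof (rule real_le_lsqrt)
    have "3 \<le> real t"
      using that t_ge_2 by simp
    then have "3 * real t \<le> real t * real t"
      by (intro mult_right_mono) auto
    then show "real t \<le> (3 / 5 * real t)\<^sup>2"
      by (simp add: power2_eq_square)
  qed auto
  show "sqrt 2 \<le> 71 / 50"
    by (rule real_le_lsqrt) (auto simp: power2_eq_square)
qed

lemma small_cone_medium: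
  assumes "real n \<le> real t ^ 7 + (real t ^ 2 - 1) * real t ^ (2 + 1) - real t ^ 3 + real t ^ 2 +
    (real t - 1) * real t ^ 2 * ((real t ^ 2 - 1) * real t ^ 2)"
  shows "small_cone t n"
proof (cases "t = 2")
  case True
  with assms have "real n \<le> 196"
    by simp
  with True show ?thesis
    by (simp add: small_cone_def)
next
  case False
  \<comment> \<open>This is exactly the target minus the assumed bound; the leading terms leave no
    slack.\<close>
  have "0 \<le> real t * (real t ^ 2 - 1)\<^sup>2"
    by simp
  also have "\<dots> = real t ^ 5 - 2 * real t ^ 3 + real t"
    by (simp add: algebra_simps eval_nat_numeral)
  finally have "real t ^ 7 + (real t ^ 2 - 1) * real t ^ (2 + 1) - real t ^ 3 + real t ^ 2 +
      (real t - 1) * real t ^ 2 * ((real t ^ 2 - 1) * real t ^ 2)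
    \<le> 2 * real t ^ 7 - real t ^ 6 + real t ^ 5 + real t ^ 4 - 4 * real t ^ 3 + real t ^ 2 + real t"
    by (simp add: algebra_simps eval_nat_numeral)
  with assms False show ?thesis
    by (simp add: small_cone_def)
qed

text \<open>The case of a polar kernel of dimension 2: radicals have at most \<open>t ^ 3\<close>
  elements, which outweighs the larger number of points of the quadric.\<close>

lemma small_cone_line_vertex:
  assumes "real n \<le> real t ^ 7 + (real t ^ 2 - 1) * real t ^ (2 + 2) - real t ^ 3 + real t ^ 2 +
    (real t - 1) * real t ^ 2 * ((real t ^ 2 - 1) * (real t * sqrt (real t)))"
  shows "small_cone t n"
proof (cases "t = 2")
  case True
  with assms have "real n \<le> 172 + 24 * sqrt 2"
    by simp
  with True show ?thesis
    using sqrt_2_le by (simp add: small_cone_def)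
next
  case False
  define T where "T = real t"
  have T3: "3 \<le> T"
    using False t_ge_2 by (simp add: T_def)
  have "real n \<le> T ^ 7 + (T ^ 2 - 1) * T ^ 4 - T ^ 3 + T ^ 2 + (T - 1) * T ^ 2 * ((T ^ 2 - 1) * (T * sqrt T))"
    using assms by (simp add: T_def)
  also have "\<dots> \<le> T ^ 7 + (T ^ 2 - 1) * T ^ 4 - T ^ 3 + T ^ 2 + (T - 1) * T ^ 2 * ((T ^ 2 - 1) * (T * (3 / 5 * T)))"
    using T3 sqrt_t_le[OF False] by (intro add_left_mono mult_left_mono) (auto simp: T_def one_le_power)
  also have "\<dots> \<le> 2 * T ^ 7 - T ^ 6 + T ^ 5 + T ^ 4 - 4 * T ^ 3 + T ^ 2 + T"
  proof -
    \<comment> \<open>The target minus the bound, with its three top terms written by completing the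
      square.\<close>
    have "0 \<le> T ^ 5 * (2 / 5 * (T - 7 / 4)\<^sup>2 + 3 / 8) + T ^ 3 * (7 / 5 * T - 3) + T"
      using T3 by (intro add_nonneg_nonneg mult_nonneg_nonneg) auto
    also have "\<dots> = (2 * T ^ 7 - T ^ 6 + T ^ 5 + T ^ 4 - 4 * T ^ 3 + T ^ 2 + T) -
        (T ^ 7 + (T ^ 2 - 1) * T ^ 4 - T ^ 3 + T ^ 2 + (T - 1) * T ^ 2 * ((T ^ 2 - 1) * (T * (3 / 5 * T))))"
      by (simp add: field_simps eval_nat_numeral)
    finally show ?thesis
      by simp
  qed
  finally show ?thesis
    using False by (simp add: small_cone_def T_def)
qed

text \<open>Having \<open>t + 1\<close> large radicals in place of \<open>t\<^sup>2 - 1\<close>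
  lowers the error from order \<open>t ^ 7 * sqrt t\<close> to
  \<open>t ^ 6 * sqrt t\<close>.\<close>

lemma small_cone_full_radical:
  assumes "real n \<le> real t ^ 7 + (real t ^ 2 - 1) * real t ^ (2 + 0) - real t ^ 3 + real t ^ 2 +
    (real t - 1) * real t ^ 2 * ((real t + 1) * (real t ^ 2 * sqrt (real t)) + (real t ^ 2 - real t - 2))"
  shows "small_cone t n"
proof (cases "t = 2")
  case True
  with assms have "real n \<le> 136 + 48 * sqrt 2"
    by simp
  with True show ?thesis
    using sqrt_2_le by (simp add: small_cone_def)
next
  case False
  define T where "T = real t"
  have T3: "3 \<le> T"
    using False t_ge_2 by (simp add: T_def)
  have "real n \<le> T ^ 7 + (T ^ 2 - 1) * T ^ 2 - T ^ 3 + T ^ 2 +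
      (T - 1) * T ^ 2 * ((T + 1) * (T ^ 2 * sqrt T) + (T ^ 2 - T - 2))"
    using assms by (simp add: T_def)
  also have "\<dots> \<le> T ^ 7 + (T ^ 2 - 1) * T ^ 2 - T ^ 3 + T ^ 2 +
      (T - 1) * T ^ 2 * ((T + 1) * (T ^ 2 * (3 / 5 * T)) + (T ^ 2 - T - 2))"
    using T3 sqrt_t_le[OF False] by (intro add_left_mono mult_left_mono add_right_mono) (auto simp: T_def)
  also have "\<dots> \<le> 2 * T ^ 7 - T ^ 6 + T ^ 5 + T ^ 4 - 4 * T ^ 3 + T ^ 2 + T"
  proof -
    have "T * 2 \<le> T * T"
      using T3 by (intro mult_left_mono) auto
    then have "0 \<le> 2 * (T * T) - 2 * T - 1"
      using T3 by linarith
    then have "0 \<le> T ^ 5 * ((T - 1) * (2 / 5 * T - 3 / 5)) + T ^ 2 * (2 * (T * T) - 2 * T - 1) + T"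
      using T3 by (intro add_nonneg_nonneg mult_nonneg_nonneg) auto
    also have "\<dots> = (2 * T ^ 7 - T ^ 6 + T ^ 5 + T ^ 4 - 4 * T ^ 3 + T ^ 2 + T) -
        (T ^ 7 + (T ^ 2 - 1) * T ^ 2 - T ^ 3 + T ^ 2 +
          (T - 1) * T ^ 2 * ((T + 1) * (T ^ 2 * (3 / 5 * T)) + (T ^ 2 - T - 2)))"
      by (simp add: field_simps eval_nat_numeral)
    finally show ?thesis
      by simp
  qed
  finally show ?thesis
    using False by (simp add: small_cone_def T_def)
qed

lemma card_radical_le_power:
  fixes A :: "'a ^ 5 ^ 5"
  assumes "\<tau> \<noteq> 0" "b \<noteq> 0" "t ^ (2 * s) \<le> card {x. polar A x = 0}" "s \<le> 5"
  shows "card (radical A \<tau> b) \<le> t ^ (5 - s)"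
proof -
  have "(card (radical A \<tau> b))\<^sup>2 * t ^ (2 * s) \<le> t ^ (2 * 5)"
    using order_trans[OF mult_le_mono2[OF assms(3)] card_radical_le[OF assms(1,2), of A]] by simp
  then have "(card (radical A \<tau> b) * t ^ s)\<^sup>2 \<le> (t ^ 5)\<^sup>2"
    by (simp add: power_mult_distrib mult.commute flip: power_mult)
  then have "card (radical A \<tau> b) * t ^ s \<le> t ^ 5"
    by (simp only: power2_nat_le_eq_le)
  also have "t ^ 5 = t ^ (5 - s) * t ^ s"
    using assms(4) by (simp flip: power_add)
  finally show ?thesis
    using t_ge_2 by simp
qed

text \<open>Along a line in direction \<open>r\<close> the form changes by
  \<open>c\<^sup>2 * quad_form A r\<close>. The hypotheses force characteristic 2, where squaring is
  injective, so each such line carries at most one zero. The line of \<open>r\<close> itself lies in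
  the polar kernel.\<close>

lemma card_quadric_nonsingular_radical:
  fixes A :: "'a ^ 5 ^ 5"
  assumes r: "polar A r = 0" "quad_form A r \<noteq> 0"
  shows "t\<^sup>2 * card {x. quad_form A x = 0} \<le> t ^ 10" "t\<^sup>2 \<le> card {x. polar A x = 0}"
proof -
  have r0: "r \<noteq> 0"
    using r by auto
  have two: "(2::'a) = 0"
    using dot_polar_self[of r A] r by simp
  have add: "quad_form A (x + c *s r) = quad_form A x + c\<^sup>2 * quad_form A r" for x c
    by (simp add: quad_form_add quad_form_scale dot_polar_commute[of "c *s r" A] dot_scale_left r)
      (simp add: dot_scale_left dot_polar_commute[of r A x] r dot_polar_commute)
  have "inj_on (\<lambda>(c, x). x + c *s r) (UNIV \<times> {x. quad_form A x = 0})"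
  proof (rule inj_onI, clarsimp)
    fix c x d y assume *: "quad_form A x = 0" "quad_form A y = 0" "x + c *s r = y + d *s r"
    have "c\<^sup>2 * quad_form A r = d\<^sup>2 * quad_form A r"
      using arg_cong[OF *(3), of "quad_form A"] by (simp add: add *(1,2))
    then have "c\<^sup>2 = d\<^sup>2"
      using r by simp
    moreover have "- d = d"
    proof -
      have "d + d = 2 * d"
        by simp
      also have "\<dots> = 0"
        by (simp only: two mult_zero_left)
      finally show ?thesis
        by (simp add: eq_neg_iff_add_eq_0 minus_equation_iff)
    qed
    ultimately have "c = d"
      by (auto simp: power2_eq_iff)
    with * show "c = d \<and> x = y"
      by simp
  qed
  then have "card (UNIV \<times> {x. quad_form A x = 0} :: ('a \<times> _) set) \<le> CARD('a ^ 5)"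
    by (intro card_inj_on_le) auto
  then show "t\<^sup>2 * card {x. quad_form A x = 0} \<le> t ^ 10"
    by (simp add: card_cartesian_product card_F flip: power_mult)
  have "inj (\<lambda>c. c *s r)"
    using r0 by (auto simp: inj_def)
  then have "CARD('a) \<le> card {x. polar A x = 0}"
    by (intro card_inj_on_le) (auto simp: polar_scale r)
  then show "t\<^sup>2 \<le> card {x. polar A x = 0}"
    by (simp add: card_F)
qed

lemma small_cone_quad_form:
  fixes A :: "'a ^ 5 ^ 5"
  assumes "(\<exists>r. polar A r = 0 \<and> quad_form A r \<noteq> 0) \<or> (\<exists>s\<le>2. card {x. polar A x = 0} = t ^ (2 * s))"
  shows "small_cone t (card {x. herm x x = 0 \<and> quad_form A x = 0})"
proof -
  have t1: "1 \<le> real t"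
    using t_ge_2 by simp
  have medium: ?thesis
    if Q: "real t ^ 2 * card {x. quad_form A x = 0} \<le> real t ^ 10 + (real t ^ 2 - 1) * real t ^ (5 + 1)"
      and R: "\<And>\<tau> b. \<tau> \<noteq> 0 \<Longrightarrow> b \<noteq> 0 \<Longrightarrow> card (radical A \<tau> b) \<le> t ^ 4"
  proof (rule small_cone_medium, rule card_cone_le[OF Q], rule sum_norm_form_sum_le)
    fix \<theta> b :: 'a assume "\<theta> + \<theta> ^ t \<noteq> 0" "b \<noteq> 0"
    then have "real (card (radical A (\<theta> + \<theta> ^ t) b)) \<le> real (t ^ 4)"
      using R by (intro of_nat_mono)
    then show "real (card (radical A (\<theta> + \<theta> ^ t) b)) \<le> (real t ^ 2)\<^sup>2"
      by (simp flip: power_mult)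
  qed simp
  show ?thesis
    using assms
  proof (elim disjE exE conjE)
    fix r assume r: "polar A r = 0" "quad_form A r \<noteq> 0"
    note R = card_quadric_nonsingular_radical[OF r]
    show ?thesis
    proof (rule medium)
      have "real (t\<^sup>2 * card {x. quad_form A x = 0}) \<le> real (t ^ 10)"
        using R(1) by (intro of_nat_mono)
      moreover have "0 \<le> (real t ^ 2 - 1) * real t ^ (5 + 1)"
        using t1 by (intro mult_nonneg_nonneg) (auto simp: one_le_power)
      ultimately show "real t ^ 2 * card {x. quad_form A x = 0} \<le>
          real t ^ 10 + (real t ^ 2 - 1) * real t ^ (5 + 1)"
        by simp
      show "card (radical A \<tau> b) \<le> t ^ 4" if "\<tau> \<noteq> 0" "b \<noteq> 0" for \<tau> b
        using card_radical_le_power[OF that, of 1 A] R(2) by simp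
    qed
  next
    fix s assume s: "s \<le> 2" "card {x. polar A x = 0} = t ^ (2 * s)"
    have Q: "real t ^ 2 * card {x. quad_form A x = 0} \<le> real t ^ 10 + (real t ^ 2 - 1) * real t ^ (5 + s)"
      using card_quadric_le[OF s(2)] by simp
    have R: "card (radical A \<tau> b) \<le> t ^ (5 - s)" if "\<tau> \<noteq> 0" "b \<noteq> 0" for \<tau> b
      using card_radical_le_power[OF that, of s A] s by simp
    \<comment> \<open>For \<open>s = 1\<close> the bound \<open>t ^ (5 - s)\<close> is already
      \<open>t ^ 4\<close>, so a larger radical forces \<open>s = 0\<close>.\<close>
    consider "s = 2" | "s \<le> 1" "\<And>\<tau> b. \<tau> \<noteq> 0 \<Longrightarrow> b \<noteq> 0 \<Longrightarrow> card (radical A \<tau> b) \<le> t ^ 4"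
      | \<tau> b where "s = 0" "\<tau> \<noteq> 0" "b \<noteq> 0" "card (radical A \<tau> b) > t ^ 4"
    proof (cases "s = 0")
      case True
      then show ?thesis
        using that by (metis not_less le0)
    next
      case False
      then show ?thesis
        using that s(1) R by (cases "s = 1") auto
    qed
    then show ?thesis
    proof cases
      case 1
      show ?thesis
      proof (rule small_cone_line_vertex, rule card_cone_le, use Q 1 in simp, rule sum_norm_form_sum_le)
        fix \<theta> b :: 'a assume "\<theta> + \<theta> ^ t \<noteq> 0" "b \<noteq> 0"
        then have "real (card (radical A (\<theta> + \<theta> ^ t) b)) \<le> real (t ^ 3)"
          using R 1 by (intro of_nat_mono) simp
        moreover have "(real t * sqrt (real t))\<^sup>2 = real t ^ 3"
          by (simp add: power_mult_distrib; simp add: eval_nat_numeral)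
        ultimately show "real (card (radical A (\<theta> + \<theta> ^ t) b)) \<le> (real t * sqrt (real t))\<^sup>2"
          by simp
      qed simp
    next
      case 2
      show ?thesis
      proof (rule medium)
        have "real t ^ (5 + s) \<le> real t ^ (5 + 1)"
          using t1 2(1) by (intro power_increasing) auto
        then have "(real t ^ 2 - 1) * real t ^ (5 + s) \<le> (real t ^ 2 - 1) * real t ^ (5 + 1)"
          using t1 by (intro mult_left_mono) (auto simp: one_le_power)
        then show "real t ^ 2 * card {x. quad_form A x = 0} \<le>
            real t ^ 10 + (real t ^ 2 - 1) * real t ^ (5 + 1)"
          using Q by linarith
      qed (use 2 in auto)
    next
      case 3
      \<comment> \<open>The gap lemma excludes every size strictly between \<open>t ^ 4\<close> and
        \<open>t ^ 5\<close>.\<close>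
      have full: "card (radical A \<tau> b) = t ^ 5"
      proof (rule ccontr)
        assume "card (radical A \<tau> b) \<noteq> t ^ 5"
        then have "card (radical A \<tau> b) < t ^ CARD(5)"
          using R[OF 3(2,3)] 3(1) by simp
        then have "card (radical A \<tau> b) * t \<le> t ^ 4 * t"
          using card_radical_gap[OF 3(2), of A b] by (simp add: eval_nat_numeral)
        then show False
          using 3(4) t_ge_2 by simp
      qed
      show ?thesis
      proof (rule small_cone_full_radical, rule card_cone_le, use Q 3(1) in simp,
          rule sum_norm_form_sum_le_full_radical[OF full 3(2,3)])
        fix \<theta> b :: 'a assume "\<theta> + \<theta> ^ t \<noteq> 0" "b \<noteq> 0"
        then have "real (card (radical A (\<theta> + \<theta> ^ t) b)) \<le> real (t ^ 5)"
          using R 3(1) by (intro of_nat_mono) simp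
        moreover have "(real t ^ 2 * sqrt (real t))\<^sup>2 = real t ^ 5"
          by (simp add: power_mult_distrib; simp add: eval_nat_numeral)
        ultimately show "real (card (radical A (\<theta> + \<theta> ^ t) b)) \<le> (real t ^ 2 * sqrt (real t))\<^sup>2"
          by simp
      next
        have "1 * 1 \<le> real t ^ 2 * sqrt (real t)"
          using t1 by (intro mult_mono) (auto simp: one_le_power)
        then show "1 \<le> real t ^ 2 * sqrt (real t)"
          by simp
      qed
    qed
  qed
qed

end

section \<open>Splitting into linear factors\<close>

context invariant_character
begin

lemma quad_form_vanishing_on_hyperplane:
  fixes A :: "'a ^ 5 ^ 5"
  assumes W: "vec.subspace W" "card W = t ^ 8" "\<And>x. x \<in> W \<Longrightarrow> quad_form A x = 0"
    and nz: "quad_form A y \<noteq> 0"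
  shows "\<exists>a b. a \<noteq> 0 \<and> b \<noteq> 0 \<and> (\<forall>x. quad_form A x = herm x a * herm x b)"
proof -
  have "W \<noteq> UNIV"
    using W(3) nz by auto
  then obtain a where a: "a \<noteq> 0" "\<And>x. x \<in> W \<Longrightarrow> herm x a = 0"
    using subspace_perp_exists[OF W(1)] by blast
  have "W \<subseteq> perp UNIV a"
    using a(2) by (auto simp: perp_def)
  then have "W = perp UNIV a"
    by (rule card_subset_eq[rotated]) (simp_all add: W(2) card_perp_UNIV[OF a(1)])
  obtain v where v: "herm v a = 1"
    using herm_unit_witness[OF a(1)] by blast
  \<comment> \<open>For \<open>x = w + l *s v\<close> with \<open>w\<close> in the hyperplane and
    \<open>l = herm x a\<close>, the value of the form is \<open>l\<close> times the linear form
    with coefficient vector \<open>k\<close>. Conjugating \<open>k\<close> turns that form into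
    \<open>herm x b\<close>.\<close>
  define k where "k = polar A v + (quad_form A v - dot v (polar A v)) *s frob_vec a"
  define b where "b = frob_vec k"
  have prod: "quad_form A x = herm x a * herm x b" for x
  proof -
    define l where "l = herm x a"
    define w where "w = x - l *s v"
    have "w \<in> W"
      unfolding \<open>W = perp UNIV a\<close> by (simp add: perp_def w_def herm_diff_left herm_scale_left v l_def)
    have x: "x = w + l *s v"
      by (simp add: w_def)
    have "quad_form A x = l\<^sup>2 * quad_form A v + l * dot w (polar A v)"
      unfolding x quad_form_add
      by (simp add: W(3)[OF \<open>w \<in> W\<close>] quad_form_scale dot_scale_left dot_polar_commute[of v A w])
    moreover have "dot x (polar A v) = dot w (polar A v) + l * dot v (polar A v)"
      by (simp add: x dot_add_left dot_scale_left)
    moreover have "herm x b = dot x (polar A v) + (quad_form A v - dot v (polar A v)) * l"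
      by (simp add: herm_eq_dot b_def k_def dot_add_right dot_scale_right l_def)
    ultimately show ?thesis
      by (simp add: l_def[symmetric] power2_eq_square algebra_simps)
  qed
  then have "b \<noteq> 0"
    using nz by auto
  with a(1) prod show ?thesis
    by blast
qed

lemma small_cone_le_power_6:
  assumes "n \<le> t ^ 6" shows "small_cone t n"
proof (cases "t = 2")
  case False
  define T where "T = real t"
  have T3: "3 \<le> T"
    using False t_ge_2 by (simp add: T_def)
  have "real n \<le> T ^ 6"
    using of_nat_mono[OF assms, where ?'a = real] by (simp add: T_def)
  also have "0 \<le> 2 * T ^ 6 * (T - 1) + T ^ 4 * (T - 3) + 4 * T ^ 3 * (T - 1) + T ^ 2 + T"
    using T3 by (intro add_nonneg_nonneg mult_nonneg_nonneg) auto
  then have "T ^ 6 \<le> 2 * T ^ 7 - T ^ 6 + T ^ 5 + T ^ 4 - 4 * T ^ 3 + T ^ 2 + T"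
    by (simp add: algebra_simps eval_nat_numeral)
  finally show ?thesis
    using False by (simp add: small_cone_def T_def)
qed (use assms in \<open>simp add: small_cone_def\<close>)

text \<open>Once the form vanishes on the polar kernel \<open>R\<close>, it lives on the quotient by
  \<open>R\<close>. Dimension 4 makes \<open>R\<close> a hyperplane of zeros. Dimension 3 leaves a
  binary form: a zero outside \<open>R\<close> spans with \<open>R\<close> a hyperplane of zeros,
  and otherwise the zeros are just the \<open>t ^ 6\<close> vectors of \<open>R\<close>.\<close>

lemma quad_form_product_or_small:
  fixes A :: "'a ^ 5 ^ 5"
  assumes nz: "quad_form A y \<noteq> 0"
  shows "(\<exists>a b. a \<noteq> 0 \<and> b \<noteq> 0 \<and> (\<forall>x. quad_form A x = herm x a * herm x b)) \<or>
    small_cone t (card {x. herm x x = 0 \<and> quad_form A x = 0})"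
proof (cases "\<exists>r. polar A r = 0 \<and> quad_form A r \<noteq> 0")
  case True
  then show ?thesis
    using small_cone_quad_form by blast
next
  case sing: False
  define R where "R = {x. polar A x = 0}"
  define s where "s = vec.dim R"
  have R: "vec.subspace R"
    unfolding R_def by (rule subspace_polar_kernel)
  have cR: "card R = t ^ (2 * s)"
    by (simp add: card_subspace[OF R] card_F s_def power_mult)
  have R0: "quad_form A x = 0" if "x \<in> R" for x
    using sing that by (auto simp: R_def)
  have "R \<noteq> UNIV"
    using R0 nz by auto
  then have "card R < CARD('a ^ 5)"
    by (intro psubset_card_mono) auto
  then have "t ^ (2 * s) < t ^ (2 * 5)"
    by (simp add: cR card_F flip: power_mult)
  then have "s < 5"
    using t_ge_2 by simp
  then consider "s \<le> 2" | "s = 3" | "s = 4"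
    by linarith
  then show ?thesis
  proof cases
    case 1
    then show ?thesis
      using small_cone_quad_form[of A] cR by (auto simp: R_def)
  next
    case 2
    show ?thesis
    proof (cases "\<exists>u. u \<notin> R \<and> quad_form A u = 0")
      case True
      then obtain u where u: "u \<notin> R" "quad_form A u = 0"
        by blast
      have "quad_form A x = 0" if "x \<in> {r + c *s u | r c. r \<in> R}" for x
      proof -
        obtain r c where "x = r + c *s u" "r \<in> R"
          using \<open>x \<in> _\<close> by blast
        then show ?thesis
          using R0[of r] u(2) by (simp add: quad_form_add quad_form_scale R_def)
      qed
      moreover have "card {r + c *s u | r c. r \<in> R} = t ^ 8"
        unfolding card_subspace_extend[OF R u(1)] by (simp add: cR 2 card_F flip: power_add)
      ultimately show ?thesis
        using quad_form_vanishing_on_hyperplane[OF subspace_extend[OF R] _ _ nz] by blast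
    next
      case False
      then have "card {x. herm x x = 0 \<and> quad_form A x = 0} \<le> card R"
        by (intro card_mono) auto
      then show ?thesis
        using small_cone_le_power_6 by (simp add: cR 2)
    qed
  next
    case 3
    then show ?thesis
      using quad_form_vanishing_on_hyperplane[OF R _ R0 nz] cR by simp
  qed
qed

end

section \<open>Forms of degree 2 and cones\<close>

lemma degree_2_monomial:
  fixes m :: "'n::finite \<Rightarrow>\<^sub>0 nat"
  assumes "(\<Sum>i\<in>UNIV. Poly_Mapping.lookup m i) = 2"
  shows "\<exists>i j. m = Poly_Mapping.single i 1 + Poly_Mapping.single j 1"
proof -
  let ?l = "Poly_Mapping.lookup m"
  have "\<exists>i. ?l i > 0"
    using assms by (metis sum.neutral not_gr_zero zero_neq_numeral)
  then obtain i where i: "?l i > 0" ..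
  have split: "?l i + sum ?l (UNIV - {i}) = 2"
    using assms by (subst (asm) sum.remove[of _ i]) auto
  show ?thesis
  proof (cases "?l i = 2")
    case True
    then have "sum ?l (UNIV - {i}) = 0"
      using split by simp
    then have "?l k = 0" if "k \<noteq> i" for k
      using that by (subst (asm) sum_eq_0_iff) auto
    then have "m = Poly_Mapping.single i 1 + Poly_Mapping.single i 1"
      using True by (intro poly_mapping_eqI) (auto simp: lookup_add lookup_single when_def)
    then show ?thesis
      by blast
  next
    case False
    then have s: "?l i = 1" "sum ?l (UNIV - {i}) = 1"
      using split i by auto
    then obtain j where j: "j \<in> UNIV - {i}" "?l j = 1" "\<forall>k\<in>UNIV - {i}. j \<noteq> k \<longrightarrow> ?l k = 0"
      unfolding sum_eq_1_iff[OF finite] by metis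
    then have "m = Poly_Mapping.single i 1 + Poly_Mapping.single j 1"
      using s(1) by (intro poly_mapping_eqI) (auto simp: lookup_add lookup_single when_def)
    then show ?thesis
      by blast
  qed
qed

lemma prod_monomial:
  fixes x :: "'a::comm_semiring_1 ^ 'n::finite"
  shows "(\<Prod>k\<in>UNIV. x $ k ^ Poly_Mapping.lookup (Poly_Mapping.single i 1 + Poly_Mapping.single j 1) k) = x $ i * x $ j"
proof -
  have "(\<Prod>k\<in>UNIV. x $ k ^ Poly_Mapping.lookup (Poly_Mapping.single i 1 + Poly_Mapping.single j 1) k) =
      (\<Prod>k\<in>UNIV. (if i = k then x $ k else 1) * (if j = k then x $ k else 1))"
    by (rule prod.cong) (auto simp: lookup_add lookup_single when_def)
  then show ?thesis
    by (simp add: prod.distrib)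
qed

lemma quad_form_sum: "quad_form A x = (\<Sum>i\<in>UNIV. \<Sum>j\<in>UNIV. A $ i $ j * (x $ i * x $ j))"
  by (simp add: quad_form_def dot_def matrix_vector_mult_def sum_distrib_left mult_ac)

text \<open>Each monomial is assigned one ordered pair of indices, and its whole coefficient goes to
  that matrix entry. Nothing is halved, so characteristic 2 is included.\<close>

lemma eval_at_eq_quad_form:
  fixes f :: "('n::finite, 'a::field) mpolynomial"
  assumes "homogeneous_of_degree 2 f"
  shows "\<exists>A. \<forall>x. eval_at f x = quad_form A x"
proof -
  have "\<forall>m\<in>Poly_Mapping.keys f. \<exists>p. m = Poly_Mapping.single (fst p) 1 + Poly_Mapping.single (snd p) 1"
    using assms degree_2_monomial by (fastforce simp: homogeneous_of_degree_def)
  then obtain p where p: "\<And>m. m \<in> Poly_Mapping.keys f \<Longrightarrow>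
      m = Poly_Mapping.single (fst (p m)) 1 + Poly_Mapping.single (snd (p m)) 1"
    by metis
  define A :: "'a ^ 'n ^ 'n" where
    "A = (\<chi> i j. \<Sum>m\<in>{m \<in> Poly_Mapping.keys f. p m = (i, j)}. Poly_Mapping.lookup f m)"
  have "eval_at f x = quad_form A x" for x
  proof -
    have "eval_at f x = (\<Sum>m\<in>Poly_Mapping.keys f. Poly_Mapping.lookup f m * (x $ fst (p m) * x $ snd (p m)))"
      unfolding eval_at_def
    proof (rule sum.cong[OF refl])
      fix m assume "m \<in> Poly_Mapping.keys f"
      then show "Poly_Mapping.lookup f m * (\<Prod>i\<in>UNIV. x $ i ^ Poly_Mapping.lookup m i) =
          Poly_Mapping.lookup f m * (x $ fst (p m) * x $ snd (p m))"
        using prod_monomial[of x "fst (p m)" "snd (p m)"] p by metis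
    qed
    also have "\<dots> = (\<Sum>q\<in>UNIV. \<Sum>m\<in>{m \<in> Poly_Mapping.keys f. p m = q}.
        Poly_Mapping.lookup f m * (x $ fst (p m) * x $ snd (p m)))"
      by (rule sum.group[symmetric]) auto
    also have "\<dots> = (\<Sum>q\<in>UNIV. A $ fst q $ snd q * (x $ fst q * x $ snd q))"
      by (simp add: A_def sum_distrib_right)
    also have "\<dots> = quad_form A x"
      by (simp add: quad_form_sum sum.cartesian_product UNIV_Times_UNIV[symmetric] case_prod_unfold
          del: UNIV_Times_UNIV)
    finally show ?thesis .
  qed
  then show ?thesis
    by blast
qed

text \<open>
  A coefficient is recovered by evaluating at a sum of at most two unit vectors: first the
  squares \<open>x\<^sub>i\<^sup>2\<close>, and when these all vanish, the mixed terms \<open>x\<^sub>i x\<^sub>j\<close>.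
\<close>

lemma eval_at_nonzero:
  fixes f :: "('n::finite, 'a::field) mpolynomial"
  assumes hom: "homogeneous_of_degree 2 f" and "f \<noteq> 0"
  shows "\<exists>x. eval_at f x \<noteq> 0"
proof -
  let ?mon = "\<lambda>i j :: 'n. Poly_Mapping.single i 1 + Poly_Mapping.single j (1::nat)"
  have mon: "\<exists>i j. m = ?mon i j" if "m \<in> Poly_Mapping.keys f" for m
    using degree_2_monomial hom that by (auto simp: homogeneous_of_degree_def)
  have eval: "eval_at f x = Poly_Mapping.lookup f m"
    if m: "m \<in> Poly_Mapping.keys f" "(\<Prod>k\<in>UNIV. x $ k ^ Poly_Mapping.lookup m k) = 1"
      and other: "\<And>m'. m' \<in> Poly_Mapping.keys f \<Longrightarrow> m' \<noteq> m \<Longrightarrow> (\<Prod>k\<in>UNIV. x $ k ^ Poly_Mapping.lookup m' k) = 0"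
    for x m
  proof -
    have "eval_at f x = (\<Sum>m\<in>{m}. Poly_Mapping.lookup f m * (\<Prod>k\<in>UNIV. x $ k ^ Poly_Mapping.lookup m k))"
      unfolding eval_at_def
    proof (rule sum.mono_neutral_right)
      show "\<forall>m'\<in>Poly_Mapping.keys f - {m}.
          Poly_Mapping.lookup f m' * (\<Prod>k\<in>UNIV. x $ k ^ Poly_Mapping.lookup m' k) = 0"
      proof
        fix m' assume "m' \<in> Poly_Mapping.keys f - {m}"
        then have "(\<Prod>k\<in>UNIV. x $ k ^ Poly_Mapping.lookup m' k) = 0"
          by (intro other) auto
        then show "Poly_Mapping.lookup f m' * (\<Prod>k\<in>UNIV. x $ k ^ Poly_Mapping.lookup m' k) = 0"
          by (simp only: mult_zero_right)
      qed
    qed (use m(1) in auto)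
    then show ?thesis
      using m(2) by simp
  qed
  show ?thesis
  proof (cases "\<exists>i. ?mon i i \<in> Poly_Mapping.keys f")
    case True
    then obtain i where i: "?mon i i \<in> Poly_Mapping.keys f" ..
    have "eval_at f (axis i 1) = Poly_Mapping.lookup f (?mon i i)"
    proof (rule eval[OF i])
      show "(\<Prod>k\<in>UNIV. (axis i 1 :: 'a ^ 'n) $ k ^ Poly_Mapping.lookup (?mon i i) k) = 1"
        unfolding prod_monomial by (simp add: axis_def)
      fix m' assume m': "m' \<in> Poly_Mapping.keys f" "m' \<noteq> ?mon i i"
      then obtain k l where kl: "m' = ?mon k l"
        using mon by blast
      with m' have "k \<noteq> i \<or> l \<noteq> i"
        by auto
      then show "(\<Prod>k\<in>UNIV. (axis i 1 :: 'a ^ 'n) $ k ^ Poly_Mapping.lookup m' k) = 0"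
        unfolding kl prod_monomial by (auto simp: axis_def)
    qed
    with i show ?thesis
      by (metis in_keys_iff)
  next
    case False
    obtain m where "m \<in> Poly_Mapping.keys f"
      using \<open>f \<noteq> 0\<close> keys_eq_empty by blast
    then obtain i j where ij: "?mon i j \<in> Poly_Mapping.keys f"
      using mon by blast
    have "i \<noteq> j"
      using False ij by auto
    have "eval_at f (axis i 1 + axis j 1) = Poly_Mapping.lookup f (?mon i j)"
    proof (rule eval[OF ij])
      show "(\<Prod>k\<in>UNIV. (axis i 1 + axis j 1 :: 'a ^ 'n) $ k ^ Poly_Mapping.lookup (?mon i j) k) = 1"
        unfolding prod_monomial using \<open>i \<noteq> j\<close> by (simp add: axis_def)
      fix m' assume m': "m' \<in> Poly_Mapping.keys f" "m' \<noteq> ?mon i j"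
      then obtain k l where kl: "m' = ?mon k l"
        using mon by blast
      have "k \<noteq> l"
        using False m'(1) kl by auto
      then have "k \<notin> {i, j} \<or> l \<notin> {i, j}"
        using m'(2) kl by (auto simp: add.commute)
      then show "(\<Prod>k\<in>UNIV. (axis i 1 + axis j 1 :: 'a ^ 'n) $ k ^ Poly_Mapping.lookup m' k) = 0"
        unfolding kl prod_monomial by (auto simp: axis_def)
    qed
    with ij show ?thesis
      by (metis in_keys_iff)
  qed
qed

section \<open>Constructing products of linear forms\<close>

lemma eval_at_superset:
  assumes "finite S" "Poly_Mapping.keys f \<subseteq> S"
  shows "eval_at f x = (\<Sum>m\<in>S. Poly_Mapping.lookup f m * (\<Prod>i\<in>UNIV. x $ i ^ Poly_Mapping.lookup m i))"
  unfolding eval_at_def by (rule sum.mono_neutral_left) (use assms in \<open>auto simp: in_keys_iff\<close>)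

lemma eval_at_add: "eval_at (f + g) x = eval_at f x + eval_at g x"
proof -
  let ?S = "Poly_Mapping.keys f \<union> Poly_Mapping.keys g"
  have "Poly_Mapping.keys (f + g) \<subseteq> ?S"
    by (rule Poly_Mapping.keys_add)
  then show ?thesis
    by (simp add: eval_at_superset[of ?S f] eval_at_superset[of ?S g] eval_at_superset[of ?S "f + g"]
        lookup_add distrib_right sum.distrib)
qed

lemma eval_at_0 [simp]: "eval_at 0 x = 0"
  by (simp add: eval_at_def)

lemma eval_at_sum: "eval_at (\<Sum>p\<in>P. g p) x = (\<Sum>p\<in>P. eval_at (g p) x)"
  by (induction P rule: infinite_finite_induct) (simp_all add: eval_at_add)

lemma eval_at_single:
  "eval_at (Poly_Mapping.single m c) x = c * (\<Prod>i\<in>UNIV. x $ i ^ Poly_Mapping.lookup m i)"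
  by (simp add: eval_at_superset[of "{m}"])

lemma homogeneous_add:
  "homogeneous_of_degree d f \<Longrightarrow> homogeneous_of_degree d g \<Longrightarrow> homogeneous_of_degree d (f + g)"
  using Poly_Mapping.keys_add[of f g] by (auto simp: homogeneous_of_degree_def)

lemma homogeneous_sum:
  "(\<And>p. p \<in> P \<Longrightarrow> homogeneous_of_degree d (g p)) \<Longrightarrow> homogeneous_of_degree d (\<Sum>p\<in>P. g p)"
  by (induction P rule: infinite_finite_induct)
    (simp_all add: homogeneous_add, simp_all add: homogeneous_of_degree_def)

text \<open>The index pairs \<open>(i, j)\<close> and \<open>(j, i)\<close> feed the same monomial,
  so coefficients may merge or cancel; that the resulting form is nonzero is derived from its values
  in \<open>quadric_section_attained\<close>.\<close>

lemma exists_form_product: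
  fixes k l :: "'a::field ^ 'n::finite"
  shows "\<exists>f. homogeneous_of_degree 2 f \<and> (\<forall>x. eval_at f x = dot x k * dot x l)"
proof -
  define g where "g = (\<lambda>(i, j). Poly_Mapping.single
    (Poly_Mapping.single i (1::nat) + Poly_Mapping.single j 1) (k $ i * l $ j))"
  have "homogeneous_of_degree 2 (g p)" for p
    by (auto simp: homogeneous_of_degree_def g_def lookup_add lookup_single when_def sum.distrib
        split: prod.split if_splits)
  then have "homogeneous_of_degree 2 (\<Sum>p\<in>UNIV. g p)"
    by (intro homogeneous_sum)
  moreover have "eval_at (\<Sum>p\<in>UNIV. g p) x = dot x k * dot x l" for x
  proof -
    have "eval_at (g p) x = (x $ fst p * k $ fst p) * (x $ snd p * l $ snd p)" for p
      unfolding g_def case_prod_unfold eval_at_single prod_monomial by (simp add: mult_ac)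
    then have "eval_at (\<Sum>p\<in>UNIV. g p) x =
        (\<Sum>p\<in>UNIV \<times> UNIV. (x $ fst p * k $ fst p) * (x $ snd p * l $ snd p))"
      by (simp add: eval_at_sum)
    also have "\<dots> = dot x k * dot x l"
      by (simp only: dot_def sum_product sum.cartesian_product case_prod_unfold)
    finally show ?thesis .
  qed
  ultimately show ?thesis
    by blast
qed

section \<open>From vectors of a cone to projective points\<close>

lemma proj_space_eq_span:
  assumes "L \<in> proj_space" "v \<in> L" "v \<noteq> 0"
  shows "L = vec.span {v}"
proof -
  have L: "vec.subspace L" "vec.dim L = 1"
    using assms(1) by (auto simp: proj_space_def)
  have "vec.independent {v}"
    using assms(3) by simp
  then have "L \<subseteq> vec.span {v}"
    using vec.card_ge_dim_independent[of "{v}" L] assms(2) L(2) by simp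
  moreover have "vec.span {v} \<subseteq> L"
    using assms(2) L(1) by (intro vec.span_minimal) auto
  ultimately show ?thesis
    by simp
qed

lemma span_in_proj_space: "v \<noteq> 0 \<Longrightarrow> vec.span {v} \<in> proj_space"
  by (simp add: proj_space_def vec.dim_span vec.dim_eq_card_independent)

text \<open>The lines in the cone, with the origin removed, partition its nonzero vectors into
  classes of one less than the order of the field.\<close>

lemma card_cone_eq:
  fixes C :: "('a::{field,finite} ^ 'n::finite) set"
  assumes "0 \<in> C" and scale: "\<And>c x. x \<in> C \<Longrightarrow> c *s x \<in> C"
  shows "card C = 1 + (CARD('a) - 1) * card {L \<in> proj_space. L \<subseteq> C}"
proof -
  let ?P = "{L \<in> proj_space. L \<subseteq> C}"
  have L0: "0 \<in> L" and cL: "card (L - {0}) = CARD('a) - 1" if "L \<in> ?P" for L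
  proof -
    have L: "vec.subspace L" "vec.dim L = 1"
      using that by (auto simp: proj_space_def)
    then show "0 \<in> L"
      using vec.subspace_0 by blast
    then show "card (L - {0}) = CARD('a) - 1"
      using card_subspace[OF L(1)] L(2) by simp
  qed
  have disj: "(L - {0}) \<inter> (L' - {0}) = {}" if "L \<in> ?P" "L' \<in> ?P" "L \<noteq> L'" for L L'
    using that proj_space_eq_span by blast
  have "C - {0} = (\<Union>L\<in>?P. L - {0})"
  proof (intro equalityI subsetI)
    fix v assume v: "v \<in> C - {0}"
    then have "vec.span {v} \<subseteq> C"
      using scale by (auto simp: vec.span_singleton)
    then have "vec.span {v} \<in> ?P"
      using v span_in_proj_space by blast
    moreover have "v \<in> vec.span {v} - {0}"
      using v vec.span_base[of v "{v}"] by simp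
    ultimately show "v \<in> (\<Union>L\<in>?P. L - {0})"
      by blast
  qed auto
  then have "card (C - {0}) = card (\<Union>L\<in>?P. L - {0})"
    by (simp only:)
  also have "\<dots> = (\<Sum>L\<in>?P. card (L - {0}))"
    by (rule card_UN_disjoint, simp, simp, use disj in blast)
  also have "\<dots> = (CARD('a) - 1) * card ?P"
    using cL by simp
  finally have "card (C - {0}) = (CARD('a) - 1) * card ?P" .
  moreover have "card C = Suc (card (C - {0}))"
    by (rule card_Suc_Diff1[OF finite assms(1), symmetric])
  ultimately show ?thesis
    by linarith
qed

section \<open>The largest sections\<close>

lemma take_4_rev_sorted_list_of_set:
  fixes S :: "nat set"
  assumes "finite S" "{a, b, c, d} \<subseteq> S" "d < c" "c < b" "b < a"
    and less: "\<And>x. x \<in> S \<Longrightarrow> x \<notin> {a, b, c, d} \<Longrightarrow> x < d"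
  shows "take 4 (rev (sorted_list_of_set S)) = [a, b, c, d]"
proof -
  define R where "R = S - {a, b, c, d}"
  have R: "finite R" "\<And>x. x \<in> R \<Longrightarrow> x < d"
    using assms(1) less by (auto simp: R_def)
  have "sorted_list_of_set S = sorted_list_of_set R @ [d, c, b, a]"
  proof (rule sorted_distinct_set_unique)
    show "sorted (sorted_list_of_set R @ [d, c, b, a])"
      using R assms(3-5) by (fastforce simp: sorted_append)
    show "distinct (sorted_list_of_set R @ [d, c, b, a])"
      using R(1) assms(3-5) by (auto simp: R_def)
    show "set (sorted_list_of_set S) = set (sorted_list_of_set R @ [d, c, b, a])"
      using R(1) assms(1,2) by (auto simp: R_def)
  qed auto
  then show ?thesis
    by simp
qed

context invariant_character
begin

lemma card_hermitian_inter_zero_set: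
  fixes f :: "(5, 'a) mpolynomial"
  assumes f: "\<And>x. eval_at f x = quad_form A x"
  shows "int (card {x. herm x x = 0 \<and> quad_form A x = 0}) =
    1 + (int t ^ 2 - 1) * int (card (hermitian_variety t \<inter> zero_set f))"
proof -
  let ?C = "{x. herm x x = 0 \<and> quad_form A x = 0}"
  have "hermitian_variety t \<inter> zero_set f = {L \<in> proj_space. L \<subseteq> ?C}"
    by (auto simp: hermitian_variety_def zero_set_def herm_def f)
  moreover have "card ?C = 1 + (CARD('a) - 1) * card {L \<in> proj_space. L \<subseteq> ?C}"
    by (rule card_cone_eq) (simp_all add: herm_scale_left herm_scale_right quad_form_scale)
  moreover have "int (t\<^sup>2 - 1) = int t ^ 2 - 1"
    using t_ge_2 by (simp add: of_nat_diff)
  ultimately show ?thesis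
    by (simp add: card_F)
qed

lemma t_square_gt_1: "int t ^ 2 - 1 > 0"
  using t_ge_2 power_strict_mono[of 1 "int t" 2] by simp

text \<open>The polynomial in \<open>small_cone\<close> is 1 plus \<open>t\<^sup>2 - 1\<close> times
  the stated bound. For \<open>t = 2\<close>, 70 points would give \<open>1 + 3 * 70 = 211\<close>
  vectors, more than 210.\<close>

lemma small_cone_points:
  assumes "small_cone t n" "int n = 1 + (int t ^ 2 - 1) * int k"
  shows "if t = 2 then k \<le> 69 else int k \<le> 2 * int t ^ 5 - int t ^ 4 + 3 * int t ^ 3 - int t + 1"
proof (cases "t = 2")
  case True
  with assms show ?thesis
    by (simp add: small_cone_def)
next
  case False
  have "real n \<le> 2 * real t ^ 7 - real t ^ 6 + real t ^ 5 + real t ^ 4 - 4 * real t ^ 3 + real t ^ 2 + real t"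
    using assms(1) False by (simp add: small_cone_def)
  then have "real_of_int (int n) \<le> real_of_int
      (2 * int t ^ 7 - int t ^ 6 + int t ^ 5 + int t ^ 4 - 4 * int t ^ 3 + int t ^ 2 + int t)"
    by simp
  then have "1 + (int t ^ 2 - 1) * int k \<le>
      2 * int t ^ 7 - int t ^ 6 + int t ^ 5 + int t ^ 4 - 4 * int t ^ 3 + int t ^ 2 + int t"
    unfolding of_int_le_iff assms(2) .
  also have "\<dots> = 1 + (int t ^ 2 - 1) * (2 * int t ^ 5 - int t ^ 4 + 3 * int t ^ 3 - int t + 1)"
    by (simp add: algebra_simps eval_nat_numeral)
  finally have "(int t ^ 2 - 1) * int k \<le>
      (int t ^ 2 - 1) * (2 * int t ^ 5 - int t ^ 4 + 3 * int t ^ 3 - int t + 1)"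
    by simp
  then have "int k \<le> 2 * int t ^ 5 - int t ^ 4 + 3 * int t ^ 3 - int t + 1"
    by (rule mult_left_le_imp_le[OF _ t_square_gt_1])
  with False show ?thesis
    by simp
qed

lemma card_quadric_section_cases:
  fixes Q :: "('a ^ 5) set set"
  assumes "Q \<in> quadrics"
  defines "k \<equiv> card (hermitian_variety t \<inter> Q)"
  shows "int k \<in> {2 * int t ^ 5 + int t ^ 3 + 2 * int t ^ 2 + 1, 2 * int t ^ 5 + int t ^ 3 + int t ^ 2 + 1,
      2 * int t ^ 5 + 2 * int t ^ 2 + 1, 2 * int t ^ 5 + int t ^ 2 + 1,
      2 * int t ^ 5 - int t ^ 3 + 2 * int t ^ 2 + 1,
      int t ^ 5 + int t ^ 3 + int t ^ 2 + 1, int t ^ 5 + int t ^ 2 + 1} \<or>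
    (if t = 2 then k \<le> 69 else int k \<le> 2 * int t ^ 5 - int t ^ 4 + 3 * int t ^ 3 - int t + 1)"
proof -
  obtain f where f: "Q = zero_set f" "f \<noteq> 0" "homogeneous_of_degree 2 f"
    using assms(1) by (auto simp: quadrics_def)
  obtain A where A: "\<And>x. eval_at f x = quad_form A x"
    using eval_at_eq_quad_form[OF f(3)] by blast
  obtain y where y: "quad_form A y \<noteq> 0"
    using eval_at_nonzero[OF f(3,2)] A by metis
  have k: "int (card {x. herm x x = 0 \<and> quad_form A x = 0}) = 1 + (int t ^ 2 - 1) * int k"
    unfolding k_def f(1) by (rule card_hermitian_inter_zero_set[OF A])
  show ?thesis
    using quad_form_product_or_small[OF y]
  proof (elim disjE exE conjE)
    fix a b assume ab: "a \<noteq> 0" "b \<noteq> 0" "\<forall>x. quad_form A x = herm x a * herm x b"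
    have "int (pair_card a b) = 1 + (int t ^ 2 - 1) * int k"
      using k ab(3) by (simp add: pair_card_def)
    moreover obtain v where v: "int (pair_card a b) = 1 + (int t ^ 2 - 1) * v"
      "v \<in> {2 * int t ^ 5 + int t ^ 3 + 2 * int t ^ 2 + 1, 2 * int t ^ 5 + int t ^ 3 + int t ^ 2 + 1,
      2 * int t ^ 5 + 2 * int t ^ 2 + 1, 2 * int t ^ 5 + int t ^ 2 + 1,
      2 * int t ^ 5 - int t ^ 3 + 2 * int t ^ 2 + 1,
      int t ^ 5 + int t ^ 3 + int t ^ 2 + 1, int t ^ 5 + int t ^ 2 + 1}"
      using pair_card_cases[OF ab(1,2)] by blast
    ultimately have "int k = v"
      using t_square_gt_1 by simp
    with v(2) show ?thesis
      by simp
  next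
    assume "small_cone t (card {x. herm x x = 0 \<and> quad_form A x = 0})"
    from small_cone_points[OF this k] show ?thesis ..
  qed
qed

lemma quadric_section_attained:
  assumes "\<exists>a b :: 'a ^ 5. a \<noteq> 0 \<and> b \<noteq> 0 \<and> int (pair_card a b) = 1 + (int t ^ 2 - 1) * int k"
  shows "k \<in> {card (hermitian_variety t \<inter> Q) | Q :: ('a ^ 5) set set. Q \<in> quadrics}"
proof -
  obtain a b :: "'a ^ 5" where ab: "a \<noteq> 0" "b \<noteq> 0"
    and k: "int (pair_card a b) = 1 + (int t ^ 2 - 1) * int k"
    using assms by blast
  obtain f where f: "homogeneous_of_degree 2 f" "\<And>x. eval_at f x = herm x a * herm x b"
    unfolding herm_eq_dot using exists_form_product[of "frob_vec a" "frob_vec b"] by blast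
  obtain A where A: "\<And>x. eval_at f x = quad_form A x"
    using eval_at_eq_quad_form[OF f(1)] by blast
  \<comment> \<open>A zero form would let two hyperplanes cover the space, but their
    \<open>2 * t ^ 8\<close> vectors are fewer than \<open>t ^ 10\<close>.\<close>
  have "f \<noteq> 0"
  proof
    assume "f = 0"
    then have "perp UNIV a \<union> perp UNIV b = (UNIV :: ('a ^ 5) set)"
      using f(2) by (auto simp: perp_def)
    then have "t ^ 10 \<le> t ^ 8 + t ^ 8"
      using card_Un_le[of "perp UNIV a" "perp UNIV b"]
      by (simp add: card_perp_UNIV ab card_F flip: power_mult)
    then have "t ^ 8 * (t * t) \<le> t ^ 8 * 2"
      by (simp add: eval_nat_numeral)
    then have "t * t \<le> 2"
      using t_ge_2 by simp
    moreover have "2 * 2 \<le> t * t"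
      using t_ge_2 by (intro mult_le_mono)
    ultimately show False
      by simp
  qed
  then have "zero_set f \<in> quadrics"
    using f(1) by (auto simp: quadrics_def)
  moreover have "pair_card a b = card {x. herm x x = 0 \<and> quad_form A x = 0}"
    by (simp only: pair_card_def A f(2)[symmetric])
  then have "card (hermitian_variety t \<inter> zero_set f) = k"
    using card_hermitian_inter_zero_set[OF A] k t_square_gt_1 by simp
  ultimately show ?thesis
    by blast
qed

end

theorem theorem6p1:
  fixes t :: nat and X :: "('a::{field,finite} ^ 5) set set"
  assumes "primepow t"
    and "CARD('a) = t\<^sup>2"
    and "X = hermitian_variety t"
  shows "take 4 (rev (sorted_list_of_set {card (X \<inter> Q) | Q. Q \<in> quadrics})) =
           [2 * t^5 + t^3 + 2 * t^2 + 1,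
            2 * t^5 + t^3 + t^2 + 1,
            2 * t^5 + 2 * t^2 + 1,
            2 * t^5 + t^2 + 1] \<and>
         (t \<noteq> 2 \<and> t \<noteq> 3 \<longrightarrow>
         (\<forall>Q \<in> quadrics.
            card (X \<inter> Q) \<notin> {2 * t^5 + t^3 + 2 * t^2 + 1,
                             2 * t^5 + t^3 + t^2 + 1,
                             2 * t^5 + 2 * t^2 + 1,
                             2 * t^5 + t^2 + 1} \<longrightarrow>
            int (card (X \<inter> Q)) = 2 * int t^5 - int t^3 + 2 * int t^2 + 1 \<or>
            int (card (X \<inter> Q)) \<le> 2 * int t^5 - int t^4 + 3 * int t^3 - int t + 1))"
proof -
  interpret quadratic_extension t "TYPE('a)"
    by unfold_locales (rule assms)+
  obtain \<psi> :: "'a \<Rightarrow> complex" where "invariant_character t \<psi>"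
    using exists_invariant_character by blast
  then interpret invariant_character t "TYPE('a)" \<psi> .
  let ?S = "{card (X \<inter> Q) | Q. Q \<in> quadrics}"
  let ?V = "{2 * t^5 + t^3 + 2 * t^2 + 1, 2 * t^5 + t^3 + t^2 + 1, 2 * t^5 + 2 * t^2 + 1, 2 * t^5 + t^2 + 1}"
  have powers: "int t ^ 2 < int t ^ 3" "int t ^ 3 < int t ^ 4" "int t ^ 4 < int t ^ 5" "int t < int t ^ 2"
    using t_ge_2 power_strict_increasing[of 1 2 "int t"] by (auto intro: power_strict_increasing)
  \<comment> \<open>For \<open>t\<close> at least 3 this brings the general bound down to
    \<open>2 * t ^ 5 - t + 1\<close>, below the fourth value.\<close>
  have three: "3 * int t ^ 3 \<le> int t ^ 4" if "t \<noteq> 2"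
    using that t_ge_2 mult_right_mono[of 3 "int t" "int t ^ 3"] by (simp add: eval_nat_numeral)
  have dichotomy: "int (card (X \<inter> Q)) = 2 * int t ^ 5 - int t ^ 3 + 2 * int t ^ 2 + 1 \<or>
      (if t = 2 then card (X \<inter> Q) \<le> 69
       else int (card (X \<inter> Q)) \<le> 2 * int t ^ 5 - int t ^ 4 + 3 * int t ^ 3 - int t + 1)"
    if Q: "Q \<in> quadrics" and V: "card (X \<inter> Q) \<notin> ?V" for Q
  proof -
    define k where "k = card (X \<inter> Q)"
    have "int k \<notin> {2 * int t ^ 5 + int t ^ 3 + 2 * int t ^ 2 + 1, 2 * int t ^ 5 + int t ^ 3 + int t ^ 2 + 1,
        2 * int t ^ 5 + 2 * int t ^ 2 + 1, 2 * int t ^ 5 + int t ^ 2 + 1}"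
    proof -
      have "int k \<notin> int ` ?V"
        unfolding k_def inj_image_mem_iff[OF inj_of_nat] by (rule V)
      then show ?thesis
        by simp
    qed
    \<comment> \<open>The second case collects the two values of a repeated hyperplane, both of
      which lie below the general bound.\<close>
    then consider "int k = 2 * int t ^ 5 - int t ^ 3 + 2 * int t ^ 2 + 1"
      | "int k \<le> int t ^ 5 + int t ^ 3 + int t ^ 2 + 1"
      | "if t = 2 then k \<le> 69 else int k \<le> 2 * int t ^ 5 - int t ^ 4 + 3 * int t ^ 3 - int t + 1"
      using card_quadric_section_cases[OF Q] powers unfolding assms(3)[symmetric] k_def[symmetric] by fastforce
    then show ?thesis
      unfolding k_def[symmetric]
    proof cases
      case 2
      have "int k \<le> 2 * int t ^ 5 - int t ^ 4 + 3 * int t ^ 3 - int t + 1"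
        using 2 powers by linarith
      moreover have "k \<le> 69" if "t = 2"
        using 2 that by simp
      ultimately show "int k = 2 * int t ^ 5 - int t ^ 3 + 2 * int t ^ 2 + 1 \<or>
          (if t = 2 then k \<le> 69 else int k \<le> 2 * int t ^ 5 - int t ^ 4 + 3 * int t ^ 3 - int t + 1)"
        by simp
    qed auto
  qed
  have "take 4 (rev (sorted_list_of_set ?S)) = [2 * t^5 + t^3 + 2 * t^2 + 1, 2 * t^5 + t^3 + t^2 + 1,
      2 * t^5 + 2 * t^2 + 1, 2 * t^5 + t^2 + 1]"
  proof (rule take_4_rev_sorted_list_of_set)
    show "finite ?S"
      by (rule finite_surj[of "quadrics :: ('a ^ 5) set set set" _ "\<lambda>Q. card (X \<inter> Q)"]) auto
    show "?V \<subseteq> ?S"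
      unfolding assms(3) insert_subset
      by (intro conjI empty_subsetI quadric_section_attained) 
        (simp_all only: of_nat_add of_nat_mult of_nat_power of_nat_numeral of_nat_1 pair_card_values_attained)
    have "t ^ 2 < t ^ 3"
      using t_ge_2 by (intro power_strict_increasing) auto
    moreover have "0 < t ^ 2"
      using t_ge_2 by simp
    ultimately show "2 * t^5 + t^2 + 1 < 2 * t^5 + 2 * t^2 + 1"
      "2 * t^5 + 2 * t^2 + 1 < 2 * t^5 + t^3 + t^2 + 1"
      "2 * t^5 + t^3 + t^2 + 1 < 2 * t^5 + t^3 + 2 * t^2 + 1"
      by simp_all
    fix x assume "x \<in> ?S" and x: "x \<notin> ?V"
    then obtain Q where Q: "Q \<in> quadrics" "x = card (X \<inter> Q)"
      by auto
    consider "int x = 2 * int t ^ 5 - int t ^ 3 + 2 * int t ^ 2 + 1" | "t = 2" "x \<le> 69"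
      | "t \<noteq> 2" "int x \<le> 2 * int t ^ 5 - int t ^ 4 + 3 * int t ^ 3 - int t + 1"
      using dichotomy[OF Q(1)] x unfolding Q(2) by (auto split: if_splits)
    then show "x < 2 * t^5 + t^2 + 1"
    proof cases
      case 1
      then have "int x < 2 * int t ^ 5 + int t ^ 2 + 1"
        using powers by linarith
      then have "int x < int (2 * t^5 + t^2 + 1)"
        by simp
      then show ?thesis
        by (simp only: of_nat_less_iff)
    next
      \<comment> \<open>The fourth value is 69 for \<open>t = 2\<close>, and \<open>x\<close>
        differs from it, so \<open>x \<le> 69\<close> is strict.\<close>
      case 2
      then show ?thesis
        using x by auto
    next
      case 3
      then have "int x < 2 * int t ^ 5 + int t ^ 2 + 1"
        using three[OF 3(1)] powers(4) t_ge_2 by linarith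
      then have "int x < int (2 * t^5 + t^2 + 1)"
        by simp
      then show ?thesis
        by (simp only: of_nat_less_iff)
    qed
  qed
  then show ?thesis
  proof (intro conjI impI ballI)
    fix Q assume Q: "t \<noteq> 2 \<and> t \<noteq> 3" "Q \<in> quadrics" "card (X \<inter> Q) \<notin> ?V"
    from dichotomy[OF Q(2,3)] Q(1)
    show "int (card (X \<inter> Q)) = 2 * int t ^ 5 - int t ^ 3 + 2 * int t ^ 2 + 1 \<or>
        int (card (X \<inter> Q)) \<le> 2 * int t ^ 5 - int t ^ 4 + 3 * int t ^ 3 - int t + 1"
      by simp
  qed
qed

end
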